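(* Let $p$ be an odd prime, $s\ge 2$ and $m\ge1$ integers, $R$ the Galois ring of characteristic $p^{s}$ and cardinality $p^{sm}$, $\nu\ge 2$ an integer and $\delta\in\{0,1,2\}$. Then the orthogonal graph $\Gamma^{2\nu+\delta}$ is quasi-strongly regular with parameters $(n,k,\lambda;c_1,c_2)$, where $$n=\frac{(p^{m\nu}-1)(p^{m(\nu+\delta-1)}+1)p^{m(s-1)(2\nu-2+\delta)}}{p^{m}-1},\qquad k=p^{ms(2\nu-2+\delta)},$$ $$\lambda=(p^{m}-1)\bigl(1+(\delta-1)p^{m(1-\nu-\frac{\delta}{2})}\bigr)p^{m(2s\nu-2s-1+s\delta)},\quad c_1=(p^{m}-1)p^{m(s(2\nu-2+\delta)-1)},\quad c_2=p^{ms(2\nu-2+\delta)}.$$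
   Context: $R$ is a finite local ring with maximal ideal $pR$ and residue field of order $p^{m}$; $R^{*}$ is its unit group and $z$ a fixed non-square element of $R^{*}$. Vectors of length $2\nu+\delta$ over $R$ having some unit coordinate are considered up to multiplication by units; $[a_1,\dots,a_{2\nu+\delta}]$ denotes the class. Let $S=\begin{pmatrix}0&I^{(\nu)}&0\\ I^{(\nu)}&0&0\\0&0&\Delta\end{pmatrix}$ with $\Delta$ absent if $\delta=0$, $\Delta=(1)$ or $(z)$ (one fixed choice) if $\delta=1$, $\Delta=\mathrm{diag}(1,-z)$ if $\delta=2$. The orthogonal graph $\Gamma^{2\nu+\delta}$ has vertices the classes $[\alpha]$ with $\alpha S\alpha^{t}=0$, and $[\alpha]\sim[\beta]$ iff $\alpha S\beta^{t}\in R^{*}$. For distinct non-negative integers $c_1,\dots,c_d$, a connected $k$-regular graph on $n$ vertices is quasi-strongly regular with parameters $(n,k,\lambda;c_1,\dots,c_d)$ if any two adjacent vertices have exactly $\lambda$ common neighbours and any two distinct non-adjacent vertices have exactly $c_i$ common neighbours for some $i$. The paper's standing assumption is $s\ge2$. *)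

theory Defs
  imports
    Complex_Main
    "HOL-Computational_Algebra.Primes"
    "HOL-Computational_Algebra.Polynomial"
    "HOL-Library.Cardinality"
    "Jordan_Normal_Form.Matrix"
    "Graph_Theory.Graph_Theory"
begin

text \<open>
  A Galois ring is a finite commutative ring with identity whose zero divisors, together with
  zero, form the principal ideal generated by \<open>p \<cdot> 1\<close> for a prime \<open>p\<close>. This ideal is then the
  unique maximal ideal, and for characteristic \<open>p ^ s\<close> and cardinality \<open>p ^ (s * m)\<close> the
  residue field has order \<open>p ^ m\<close>. The ring is the whole type.
\<close>

definition galois_ring :: "'a::{finite, comm_ring_1} itself \<Rightarrow> nat \<Rightarrow> nat \<Rightarrow> nat \<Rightarrow> bool" where
  "galois_ring R p s m \<longleftrightarrow>
     prime p \<and> CHAR('a) = p ^ s \<and> CARD('a) = p ^ (s * m) \<and>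
     {x::'a. x = 0 \<or> (\<exists>y. y \<noteq> 0 \<and> x * y = 0)} = range (\<lambda>r::'a. of_nat p * r)"

text \<open>
  The argument \<open>e\<close> is the single entry of \<open>\<Delta>\<close> in the case \<open>\<delta> = 1\<close>, where it is to be \<open>1\<close> or \<open>z\<close>;
  it is irrelevant otherwise.
\<close>

definition orth_Delta :: "nat \<Rightarrow> 'a::comm_ring_1 \<Rightarrow> 'a \<Rightarrow> 'a mat" where
  "orth_Delta \<delta> z e =
     (if \<delta> = 0 then 0\<^sub>m 0 0
      else if \<delta> = 1 then mat_of_rows_list 1 [[e]]
      else mat_of_rows_list 2 [[1, 0], [0, - z]])"

definition orth_matrix :: "nat \<Rightarrow> nat \<Rightarrow> 'a::comm_ring_1 \<Rightarrow> 'a \<Rightarrow> 'a mat" where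
  "orth_matrix \<nu> \<delta> z e =
     four_block_mat
       (four_block_mat (0\<^sub>m \<nu> \<nu>) (1\<^sub>m \<nu>) (1\<^sub>m \<nu>) (0\<^sub>m \<nu> \<nu>)) (0\<^sub>m (2 * \<nu>) \<delta>)
       (0\<^sub>m \<delta> (2 * \<nu>)) (orth_Delta \<delta> z e)"

text \<open>The scalar \<open>\<alpha> S \<beta>\<^sup>t\<close>.\<close>

definition orth_form ::
    "nat \<Rightarrow> nat \<Rightarrow> 'a::comm_ring_1 \<Rightarrow> 'a \<Rightarrow> 'a vec \<Rightarrow> 'a vec \<Rightarrow> 'a" where
  "orth_form \<nu> \<delta> z e \<alpha> \<beta> = \<alpha> \<bullet> (orth_matrix \<nu> \<delta> z e *\<^sub>v \<beta>)"

definition unit_class :: "'a::comm_ring_1 vec \<Rightarrow> 'a vec set" where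
  "unit_class \<alpha> = {u \<cdot>\<^sub>v \<alpha> | u. u dvd 1}"

definition isotropic_vecs :: "nat \<Rightarrow> nat \<Rightarrow> 'a::comm_ring_1 \<Rightarrow> 'a \<Rightarrow> 'a vec set" where
  "isotropic_vecs \<nu> \<delta> z e =
     {\<alpha> \<in> carrier_vec (2 * \<nu> + \<delta>).
        (\<exists>i < 2 * \<nu> + \<delta>. \<alpha> $ i dvd 1) \<and> orth_form \<nu> \<delta> z e \<alpha> \<alpha> = 0}"

text \<open>
  Adjacency does not depend on the representatives, since passing to other representatives
  multiplies \<open>\<alpha> S \<beta>\<^sup>t\<close> by a unit.
\<close>

definition orthogonal_graph ::
    "nat \<Rightarrow> nat \<Rightarrow> 'a::comm_ring_1 \<Rightarrow> 'a \<Rightarrow> 'a vec set pair_pre_digraph" where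
  "orthogonal_graph \<nu> \<delta> z e =
     \<lparr> pverts = unit_class ` isotropic_vecs \<nu> \<delta> z e,
       parcs = {(unit_class \<alpha>, unit_class \<beta>) | \<alpha> \<beta>.
                  \<alpha> \<in> isotropic_vecs \<nu> \<delta> z e \<and> \<beta> \<in> isotropic_vecs \<nu> \<delta> z e \<and>
                  orth_form \<nu> \<delta> z e \<alpha> \<beta> dvd 1} \<rparr>"

definition neighbours :: "'v pair_pre_digraph \<Rightarrow> 'v \<Rightarrow> 'v set" where
  "neighbours G u = {w \<in> pverts G. (u, w) \<in> parcs G}"

text \<open>
  The locale predicate \<^const>\<open>pair_graph\<close> expresses that \<open>G\<close> is a finite simple undirected graph
  (symmetric arc set without loops).
\<close>

definition quasi_strongly_regular ::
    "'v pair_pre_digraph \<Rightarrow> nat \<Rightarrow> nat \<Rightarrow> nat \<Rightarrow> nat list \<Rightarrow> bool" where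
  "quasi_strongly_regular G n k l cs \<longleftrightarrow>
     distinct cs \<and> pair_graph G \<and> connected (with_proj G) \<and>
     card (pverts G) = n \<and>
     (\<forall>u \<in> pverts G. card (neighbours G u) = k) \<and>
     (\<forall>u \<in> pverts G. \<forall>v \<in> pverts G. (u, v) \<in> parcs G \<longrightarrow>
        card (neighbours G u \<inter> neighbours G v) = l) \<and>
     (\<forall>u \<in> pverts G. \<forall>v \<in> pverts G. u \<noteq> v \<and> (u, v) \<notin> parcs G \<longrightarrow>
        card (neighbours G u \<inter> neighbours G v) \<in> set cs)"

end

theory Submission
  imports Defs "HOL-Library.Function_Algebras"
begin

text \<open>
  Let \<open>P = pR\<close> be the set of non-units and \<open>Q(x) = x S x\<^sup>t\<close>. Every isotropic vector \<open>\<alpha>\<close> with a unit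
  coordinate lies in a hyperbolic pair \<open>(\<alpha>, f)\<close>, and \<open>w \<mapsto> [f + w - Q(w)/2 \<alpha>]\<close> parametrises the neighbours
  of \<open>[\<alpha>]\<close> by the orthogonal complement \<open>W\<close> of the pair. Being adjacent to a further vertex \<open>[\<beta>]\<close> then
  becomes a condition on \<open>w\<close>: that \<open>Q(w)\<close> is a unit if \<open>[\<beta>] \<sim> [\<alpha>]\<close> (take \<open>f\<close> proportional to \<open>\<beta>\<close>), and
  otherwise that an affine function of \<open>w\<close> is a unit modulo \<open>P\<close>. No cancellation theorem is needed to
  count the \<open>w \<in> W\<close> with \<open>Q(w) \<in> P\<close>: splitting the whole space as \<open>R\<alpha> + Rf + W\<close> expresses the number of
  all vectors with \<open>Q \<in> P\<close> through it, and the latter number, like the number of isotropic vectors,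
  is read off the coordinates \<open>Q(a, b, c) = 2 a \<cdot> b + \<Delta>(c)\<close>.
\<close>

section \<open>Local rings in which two is invertible\<close>

text \<open>The hypotheses make \<open>A\<close> a finite subgroup on which \<open>\<phi>\<close> is
  a homomorphism, so its nonempty fibres are translates of the kernel and have equal size. The
  product form avoids division.\<close>

lemma card_preimage_additive:
  fixes \<phi> :: "'b::ab_group_add \<Rightarrow> 'c::ab_group_add"
  assumes fin: "finite A" and ne: "A \<noteq> {}"
    and diff: "\<And>x y. x \<in> A \<Longrightarrow> y \<in> A \<Longrightarrow> x - y \<in> A"
    and hom: "\<And>x y. x \<in> A \<Longrightarrow> y \<in> A \<Longrightarrow> \<phi> (x - y) = \<phi> x - \<phi> y"
    and T: "T \<subseteq> \<phi> ` A"
  shows "card {a \<in> A. \<phi> a \<in> T} * card (\<phi> ` A) = card A * card T"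
proof -
  define K where "K = {a \<in> A. \<phi> a = 0}"
  have zero: "0 \<in> A" using ne diff by (metis all_not_in_conv diff_self)
  have plus: "x + y \<in> A" if "x \<in> A" "y \<in> A" for x y
    using diff[OF that(1) diff[OF zero that(2)]] by simp
  have hom_plus: "\<phi> (x + y) = \<phi> x + \<phi> y" if "x \<in> A" "y \<in> A" for x y
    using hom[OF plus[OF that] that(2)] by simp
  have fibre: "card {a \<in> A. \<phi> a = t} = card K" if "t \<in> \<phi> ` A" for t
  proof -
    from that obtain a where a: "a \<in> A" "\<phi> a = t" by auto
    have "bij_betw (\<lambda>x. x - a) {a \<in> A. \<phi> a = t} K"
      by (rule bij_betwI[where g = "\<lambda>x. x + a"])
        (auto simp: K_def a hom diff plus hom_plus)
    then show ?thesis by (rule bij_betw_same_card)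
  qed
  have count: "card {a \<in> A. \<phi> a \<in> S} = card S * card K" if "S \<subseteq> \<phi> ` A" for S
  proof -
    have "finite S" using that fin by (meson finite_imageI finite_subset)
    have "{a \<in> A. \<phi> a \<in> S} = (\<Union>t\<in>S. {a \<in> A. \<phi> a = t})" by auto
    also have "card \<dots> = (\<Sum>t\<in>S. card {a \<in> A. \<phi> a = t})"
      by (rule card_UN_disjoint) (use \<open>finite S\<close> fin in auto)
    also have "\<dots> = card S * card K" using that fibre by (simp add: subset_iff)
    finally show ?thesis .
  qed
  have "{a \<in> A. \<phi> a \<in> \<phi> ` A} = A" by auto
  then show ?thesis using count[OF T] count[of "\<phi> ` A"] by simp
qed

text \<open>Locality is expressed by closure of the non-units under addition; \<open>h\<close> is
  the inverse of 2, by which quadratic values are halved.\<close>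

locale odd_local_ring =
  fixes P :: "'a::{finite, comm_ring_1} set" and h :: 'a
  assumes P_iff: "x \<in> P \<longleftrightarrow> \<not> x dvd 1"
    and P_add: "x \<in> P \<Longrightarrow> y \<in> P \<Longrightarrow> x + y \<in> P"
    and two_half: "2 * h = 1"
begin

lemma half_add_half: "h * x + h * x = x"
proof -
  have "h * x + h * x = 2 * h * x" by (simp only: mult_2 distrib_right)
  then show ?thesis by (simp add: two_half)
qed

lemma zero_in_P [simp]: "0 \<in> P" and one_notin_P [simp]: "1 \<notin> P"
  by (auto simp: P_iff)

lemma not_in_P_iff: "x \<notin> P \<longleftrightarrow> x dvd 1"
  by (simp add: P_iff)

lemma mult_in_P_iff: "x * y \<in> P \<longleftrightarrow> x \<in> P \<or> y \<in> P"
proof -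
  have "x * y dvd 1" if x: "x dvd 1" and y: "y dvd 1"
    using mult_dvd_mono[OF x y] by simp
  then show ?thesis unfolding P_iff using dvd_mult_left[of x y 1] dvd_mult_right[of x y 1] by blast
qed

lemma uminus_in_P_iff [simp]: "- x \<in> P \<longleftrightarrow> x \<in> P"
  by (simp add: P_iff)

lemma P_diff: "x \<in> P \<Longrightarrow> y \<in> P \<Longrightarrow> x - y \<in> P"
  using P_add[of x "- y"] by simp

lemma add_in_P_iff: "y \<in> P \<Longrightarrow> x + y \<in> P \<longleftrightarrow> x \<in> P"
  using P_add[of x y] P_diff[of "x + y" y] by auto

lemma add_in_P_iff': "y \<in> P \<Longrightarrow> y + x \<in> P \<longleftrightarrow> x \<in> P"
  by (subst add.commute) (rule add_in_P_iff)

lemma diff_in_P_iff: "y \<in> P \<Longrightarrow> x - y \<in> P \<longleftrightarrow> x \<in> P"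
  using add_in_P_iff[of "- y" x] by simp

lemma P_sum: "(\<And>i. i \<in> I \<Longrightarrow> g i \<in> P) \<Longrightarrow> sum g I \<in> P"
  by (induction I rule: infinite_finite_induct) (auto intro: P_add)

lemma two_notin_P [simp]: "2 \<notin> P" and half_notin_P [simp]: "h \<notin> P"
  using one_notin_P[folded two_half] by (auto simp only: mult_in_P_iff)

lemma square_in_P_iff: "x ^ 2 \<in> P \<longleftrightarrow> x \<in> P"
  by (simp add: power2_eq_square mult_in_P_iff)

lemma unit_inverse:
  assumes "u \<notin> P" obtains v where "u * v = 1" "v * u = 1" "v \<notin> P"
proof -
  from assms obtain v where v: "u * v = 1" unfolding P_iff by (metis dvdE)
  then have "v \<notin> P" by (metis mult_in_P_iff one_notin_P)
  with v show thesis using that by (simp add: mult.commute)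
qed

text \<open>Squaring is injective on the finite set \<open>1 + P\<close>, because \<open>2\<close> is a unit, hence bijective.\<close>

lemma square_of_cong_square:
  assumes z: "z \<notin> P" and "z - y ^ 2 \<in> P"
  shows "\<exists>x. z = x ^ 2"
proof -
  let ?A = "{x. x - 1 \<in> P}"
  have "inj_on (\<lambda>x. x ^ 2) ?A"
  proof (rule inj_onI)
    fix a b assume ab: "a \<in> ?A" "b \<in> ?A" "a ^ 2 = b ^ 2"
    have "2 + ((a - 1) + (b - 1)) \<notin> P"
      using ab P_add[of "a - 1" "b - 1"] add_in_P_iff two_notin_P by blast
    then have "a + b \<notin> P" by simp
    then obtain v where v: "(a + b) * v = 1" by (rule unit_inverse)
    have "(a - b) * (a + b) = 0" using ab(3) by (simp add: algebra_simps power2_eq_square)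
    then have "(a - b) * ((a + b) * v) = 0" by (metis mult.assoc mult_zero_left)
    then show "a = b" using v by simp
  qed
  moreover have "(\<lambda>x. x ^ 2) ` ?A \<subseteq> ?A"
  proof clarsimp
    fix x assume "x - 1 \<in> P"
    moreover have "x ^ 2 - 1 = (x - 1) * (x + 1)" by (simp add: algebra_simps power2_eq_square)
    ultimately show "x ^ 2 - 1 \<in> P" by (simp add: mult_in_P_iff)
  qed
  ultimately have surj: "(\<lambda>x. x ^ 2) ` ?A = ?A" by (simp add: endo_inj_surj)
  have "y \<notin> P"
  proof
    assume "y \<in> P"
    then show False using assms P_add[of "z - y ^ 2" "y ^ 2"] by (simp add: square_in_P_iff)
  qed
  \<comment> \<open>Division by \<open>y ^ 2\<close> moves \<open>z\<close> into
    \<open>1 + P\<close>, where every element is a square.\<close>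
  then obtain v where v: "y * v = 1" by (rule unit_inverse)
  have v2: "y ^ 2 * v ^ 2 = 1" by (metis v power_mult_distrib power_one)
  have "z * v ^ 2 - 1 = (z - y ^ 2) * v ^ 2" using v2 by (simp add: algebra_simps)
  then have "z * v ^ 2 \<in> ?A" using assms by (simp add: mult_in_P_iff)
  then obtain x where x: "z * v ^ 2 = x ^ 2" using surj by (metis imageE)
  have "z = z * v ^ 2 * y ^ 2" using v2 by (simp add: mult.assoc mult.commute[of "v ^ 2"])
  also have "\<dots> = (x * y) ^ 2" using x by (simp add: power_mult_distrib)
  finally show ?thesis by blast
qed

text \<open>If \<open>y\<close> were a unit, \<open>z\<close> would be congruent to
  \<open>(x / y) ^ 2\<close> modulo \<open>P\<close> and hence a square by the preceding lemma. This
  is the anisotropy modulo \<open>P\<close> of \<open>\<Delta>\<close> for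
  \<open>\<delta> = 2\<close>.\<close>

lemma norm_form_in_P:
  assumes z: "z \<notin> P" "\<nexists>y. z = y ^ 2" and xy: "x * x - z * (y * y) \<in> P"
  shows "x \<in> P \<and> y \<in> P"
proof -
  have "y \<in> P"
  proof (rule ccontr)
    assume "y \<notin> P"
    then obtain v where v: "y * v = 1" by (rule unit_inverse)
    have "z - (x * v) ^ 2 = z * (y * v) ^ 2 - (x * v) ^ 2" by (simp add: v)
    also have "\<dots> = - (x * x - z * (y * y)) * v ^ 2"
      by (simp add: algebra_simps power2_eq_square)
    finally have "z - (x * v) ^ 2 = - (x * x - z * (y * y)) * v ^ 2" .
    then have "z - (x * v) ^ 2 \<in> P" using xy by (metis mult_in_P_iff uminus_in_P_iff)
    then show False using square_of_cong_square z by blast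
  qed
  moreover from this have "x * x \<in> P"
    using P_add[OF xy, of "z * (y * y)"] by (simp add: mult_in_P_iff)
  ultimately show ?thesis by (simp add: mult_in_P_iff)
qed

lemma finite_P [simp]: "finite P"
  by simp

lemma card_units: "card (- P) = CARD('a) - card P"
  by (simp add: Compl_eq_Diff_UNIV card_Diff_subset)

lemma card_P_less: "card P < CARD('a)"
  using one_notin_P by (intro psubset_card_mono) (simp, blast)

end

section \<open>Galois rings of odd characteristic as local rings\<close>

text \<open>Multiplication by \<open>x\<close> on a finite ring is surjective as soon as it is
  injective, so a non-unit annihilates some nonzero element. The ideal in the definition of a Galois
  ring is therefore the set of non-units.\<close>

lemma galois_ring_nonunit_iff:
  assumes "galois_ring TYPE('a::{finite, comm_ring_1}) p s m"
  shows "\<not> (x::'a) dvd 1 \<longleftrightarrow> x \<in> range (\<lambda>r. of_nat p * r)"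
proof -
  have "\<not> x dvd 1 \<longleftrightarrow> x = 0 \<or> (\<exists>y. y \<noteq> 0 \<and> x * y = 0)"
  proof
    assume nu: "\<not> x dvd 1"
    have "\<not> inj ((*) x)"
    proof
      assume "inj ((*) x)"
      then have "surj ((*) x)" by (simp add: finite_UNIV_inj_surj)
      then have "x dvd 1" by (metis dvdI surjD)
      with nu show False ..
    qed
    then obtain a b where "x * a = x * b" "a \<noteq> b" by (auto simp: inj_on_def)
    then have "x * (a - b) = 0" "a - b \<noteq> 0" by (simp_all add: algebra_simps)
    then show "x = 0 \<or> (\<exists>y. y \<noteq> 0 \<and> x * y = 0)" by blast
  next
    assume *: "x = 0 \<or> (\<exists>y. y \<noteq> 0 \<and> x * y = 0)"
    show "\<not> x dvd 1"
    proof
      assume "x dvd 1"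
      then obtain u where u: "u * x = 1" by (metis dvdE mult.commute)
      then have "x \<noteq> 0" by auto
      with * obtain y where "y \<noteq> 0" "x * y = 0" by blast
      then show False using u by (metis mult.assoc mult_1 mult_zero_right)
    qed
  qed
  then show ?thesis using assms unfolding galois_ring_def by blast
qed

text \<open>Non-units are the multiples of \<open>p\<close>, hence closed under addition. Were 2 a
  non-unit, so would be \<open>1 = p - 2 * (p div 2)\<close>.\<close>

lemma galois_ring_odd_local_ring:
  assumes gr: "galois_ring TYPE('a::{finite, comm_ring_1}) p s m" and "odd p"
  obtains h :: "'a::{finite, comm_ring_1}" where "odd_local_ring {x. \<not> x dvd 1} h"
proof -
  note iff = galois_ring_nonunit_iff[OF gr]
  have add: "\<not> x + y dvd 1" if "\<not> x dvd 1" "\<not> y dvd 1" for x y :: 'a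
  proof -
    from that obtain a b where "x = of_nat p * a" "y = of_nat p * b" unfolding iff by blast
    then have "x + y = of_nat p * (a + b)" by (simp add: distrib_left)
    then show ?thesis unfolding iff by blast
  qed
  have "(2::'a) dvd 1"
  proof (rule ccontr)
    assume "\<not> (2::'a) dvd 1"
    then have 1: "\<not> - (2 * of_nat (p div 2)) dvd (1::'a)"
      by (auto dest: dvd_mult_left)
    have 2: "\<not> of_nat p dvd (1::'a)" unfolding iff by (metis mult_1_right rangeI)
    have "p = 2 * (p div 2) + 1" using \<open>odd p\<close> by presburger
    then have "of_nat p = (2 * of_nat (p div 2) + 1 :: 'a)"
      by (metis of_nat_1 of_nat_add of_nat_mult of_nat_numeral)
    then show False using add[OF 2 1] by simp
  qed
  then obtain h :: 'a where "2 * h = 1" by (metis dvdE)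
  with add show thesis by (intro that[of h]) (unfold_locales, auto)
qed

text \<open>
  The filtration by the ideals \<open>p ^ i R\<close> has all its \<open>s\<close> factors isomorphic to the residue field.
\<close>

lemma galois_ring_card_nonunits:
  assumes gr: "galois_ring TYPE('a::{finite, comm_ring_1}) p s m" and "s > 0"
  shows "card {x::'a. \<not> x dvd 1} = p ^ (m * (s - 1))"
proof -
  define P where "P = {x::'a. \<not> x dvd 1}"
  define J where "J i = range (\<lambda>r::'a. of_nat p ^ i * r)" for i
  note iff = galois_ring_nonunit_iff[OF gr]
  have char: "CHAR('a) = p ^ s" and cardR: "CARD('a) = p ^ (s * m)" and p: "prime p"
    using gr by (auto simp: galois_ring_def)
  have p0: "(of_nat p :: 'a) ^ i \<noteq> 0" if "i < s" for i
  proof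
    assume "(of_nat p :: 'a) ^ i = 0"
    then have "of_nat (p ^ i) = (0::'a)" by simp
    then have "p ^ s dvd p ^ i" using char by (simp only: of_nat_eq_0_iff_char_dvd)
    then show False using that p by (meson leD power_dvd_imp_le prime_gt_1_nat)
  qed
  have ps: "(of_nat p :: 'a) ^ s = 0"
    using of_nat_CHAR[where 'a = 'a] char by simp
  \<comment> \<open>Multiplication by \<open>p ^ i\<close> maps the ring onto \<open>J i\<close>,
    and the preimage of \<open>J (Suc i)\<close> is exactly \<open>P\<close>; so
    \<open>J (Suc i)\<close> has in \<open>J i\<close> the same index as \<open>P\<close> in the
    ring.\<close>
  have step: "card P * card (J i) = CARD('a) * card (J (Suc i))" if "i < s" for i
  proof -
    have "of_nat p ^ i * r \<in> J (Suc i) \<longleftrightarrow> r \<in> P" for r :: 'a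
    proof
      assume "of_nat p ^ i * r \<in> J (Suc i)"
      then obtain t where t: "of_nat p ^ i * r = of_nat p ^ i * (of_nat p * t)"
        by (auto simp: J_def mult_ac)
      then have eq0: "of_nat p ^ i * (r - of_nat p * t) = 0" by (simp add: algebra_simps)
      have "\<not> r - of_nat p * t dvd 1"
      proof
        assume "r - of_nat p * t dvd 1"
        then obtain u where "(r - of_nat p * t) * u = 1" by (metis dvdE)
        then have "of_nat p ^ i = (0::'a)" using eq0 by (metis mult.assoc mult_1_right mult_zero_left)
        with p0[OF that] show False by blast
      qed
      then obtain v where "r - of_nat p * t = of_nat p * v" unfolding iff by blast
      then have "r = of_nat p * (v + t)" by (simp add: algebra_simps)
      then show "r \<in> P" unfolding P_def using iff by blast
    next
      assume "r \<in> P"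
      then obtain v where "r = of_nat p * v" unfolding P_def using iff by auto
      then have "of_nat p ^ i * r = of_nat p ^ Suc i * v" by (simp add: mult_ac)
      then show "of_nat p ^ i * r \<in> J (Suc i)" unfolding J_def by blast
    qed
    moreover have "J (Suc i) \<subseteq> J i" by (auto simp: J_def mult.assoc power_Suc2 simp del: power_Suc)
    ultimately show ?thesis
      using card_preimage_additive[of "UNIV :: 'a set" "\<lambda>r. of_nat p ^ i * r" "J (Suc i)"]
      by (simp add: J_def right_diff_distrib)
  qed
  have "card (J i) * CARD('a) ^ i = CARD('a) * card P ^ i" if "i \<le> s" for i
    using that
  proof (induction i)
    case 0
    then show ?case by (simp add: J_def)
  next
    case (Suc i)
    have "card (J (Suc i)) * CARD('a) ^ Suc i = CARD('a) * card (J (Suc i)) * CARD('a) ^ i"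
      by (simp add: mult_ac)
    also have "\<dots> = card P * (card (J i) * CARD('a) ^ i)"
      using step[of i] Suc.prems by (simp add: mult.assoc)
    finally show ?case using Suc by simp
  qed
  \<comment> \<open>Since \<open>p ^ s = 0\<close>, \<open>J s\<close> is a single point. The
    telescoped equation then determines \<open>card P ^ s\<close>, and roots of natural numbers are
    unique.\<close>
  from this[of s] have "CARD('a) ^ s = CARD('a) * card P ^ s" by (simp add: J_def ps)
  also have "CARD('a) ^ s = CARD('a) * CARD('a) ^ (s - 1)"
    using \<open>s > 0\<close> by (metis Suc_diff_1 power_Suc)
  finally have "card P ^ s = CARD('a) ^ (s - 1)" by simp
  also have "\<dots> = (p ^ (m * (s - 1))) ^ s"
    by (simp only: cardR power_mult[symmetric] mult_ac)
  finally show ?thesis unfolding P_def using \<open>s > 0\<close> by (auto intro: power_eq_imp_eq_base)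
qed

section \<open>Quadratic modules over such rings\<close>

text \<open>The neighbour counts use only a finite submodule \<open>V\<close> with a symmetric
  bilinear form, so they are carried out without coordinates.\<close>

locale quadratic_module = odd_local_ring P h + Modules.module scale
  for P :: "'a::{finite, comm_ring_1} set" and h :: 'a
    and scale :: "'a \<Rightarrow> 'v::ab_group_add \<Rightarrow> 'v" (infixr \<open>*s\<close> 75) +
  fixes V :: "'v set" and B :: "'v \<Rightarrow> 'v \<Rightarrow> 'a"
  assumes V: "subspace V" and fin_V: "finite V"
    and B_add_left: "B (x + y) w = B x w + B y w"
    and B_scale_left: "B (c *s x) w = c * B x w"
    and B_sym: "B x y = B y x"
begin

lemma B_add_right: "B w (x + y) = B w x + B w y"
  and B_scale_right: "B w (c *s x) = c * B w x"
  by (simp_all add: B_sym[of w] B_add_left B_scale_left)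

lemma B_zero [simp]: "B 0 x = 0" "B x 0 = 0"
  using B_scale_left[of 0 0 x] B_scale_right[of x 0 0] by simp_all

lemma B_minus_left: "B (- x) y = - B x y" and B_minus_right: "B x (- y) = - B x y"
  using B_scale_left[of "- 1" x y] B_scale_right[of x "- 1" y] by simp_all

lemma B_diff_left: "B (x - y) w = B x w - B y w" and B_diff_right: "B w (x - y) = B w x - B w y"
  using B_add_left[of x "- y"] B_add_right[of w x "- y"] by (simp_all add: B_minus_left B_minus_right)

lemmas bilinear = B_add_left B_add_right B_scale_left B_scale_right B_minus_left B_minus_right
  B_diff_left B_diff_right

lemmas V_closed = subspace_add[OF V] subspace_diff[OF V] subspace_scale[OF V] subspace_0[OF V]

section \<open>Hyperbolic pairs and their orthogonal complements\<close>

text \<open>Coordinate-free substitute for having a unit coordinate; \<open>primitive_iff\<close>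
  shows that the two agree for the orthogonal form.\<close>

definition primitive :: "'v \<Rightarrow> bool" where
  "primitive x \<longleftrightarrow> (\<exists>y\<in>V. B x y \<notin> P)"

definition isotropic :: "'v set" where
  "isotropic = {x \<in> V. primitive x \<and> B x x = 0}"

definition hyperbolic :: "'v \<Rightarrow> 'v \<Rightarrow> bool" where
  "hyperbolic x y \<longleftrightarrow> x \<in> V \<and> y \<in> V \<and> B x x = 0 \<and> B y y = 0 \<and> B x y = 1"

definition perp :: "'v \<Rightarrow> 'v \<Rightarrow> 'v set" where
  "perp x y = {w \<in> V. B x w = 0 \<and> B y w = 0}"

definition line :: "'v \<Rightarrow> 'v set" where
  "line x = (\<lambda>u. u *s x) ` (- P)"

lemma finite_perp [simp]: "finite (perp x y)"
  using fin_V by (simp add: perp_def)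

lemma perpD:
  assumes "w \<in> perp x y"
  shows "w \<in> V" "B x w = 0" "B y w = 0" "B w x = 0" "B w y = 0"
  using assms B_sym[of w x] B_sym[of w y] by (auto simp: perp_def)

lemma hyperbolicD:
  assumes "hyperbolic x y"
  shows "x \<in> V" "y \<in> V" "B x x = 0" "B y y = 0" "B x y = 1" "B y x = 1"
  using assms B_sym[of y x] by (auto simp: hyperbolic_def)

text \<open>Scale a vector pairing to a unit with \<open>x\<close> so that the value becomes 1, then
  subtract half its quadratic value times \<open>x\<close>. As \<open>x\<close> is isotropic, this
  keeps the pairing and makes the vector isotropic.\<close>

lemma hyperbolic_exists:
  assumes "x \<in> isotropic" obtains y where "hyperbolic x y"
proof -
  from assms obtain y where x: "x \<in> V" "B x x = 0" and y: "y \<in> V" "B x y \<notin> P"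
    by (auto simp: isotropic_def primitive_def)
  from y(2) obtain v where v: "B x y * v = 1" "v * B x y = 1" by (rule unit_inverse)
  define y' where "y' = v *s y"
  have y': "y' \<in> V" "B x y' = 1" "B y' x = 1"
    using y v B_sym[of y x] by (auto simp: y'_def V_closed bilinear)
  have "B y' y' - h * B y' y' - h * B y' y' = 0"
    using half_add_half[of "B y' y'"] by (simp add: algebra_simps)
  then have "hyperbolic x (y' - (h * B y' y') *s x)"
    using x y' by (simp add: hyperbolic_def V_closed bilinear)
  then show thesis by (rule that)
qed

lemma hyperbolic_rescale:
  assumes "x \<in> isotropic" "y \<in> isotropic" "B x y \<notin> P"
  obtains v where "v \<notin> P" "hyperbolic x (v *s y)"
proof -
  from assms(3) obtain v where "B x y * v = 1" "v * B x y = 1" "v \<notin> P" by (rule unit_inverse)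
  with assms have "hyperbolic x (v *s y)"
    by (simp add: hyperbolic_def isotropic_def V_closed bilinear)
  with \<open>v \<notin> P\<close> show thesis by (rule that)
qed

lemma hyperbolic_decomposition:
  assumes "hyperbolic x y"
  shows "bij_betw (\<lambda>(a, b, w). a *s x + b *s y + w) (UNIV \<times> UNIV \<times> perp x y) V"
proof -
  note * = hyperbolicD[OF assms]
  show ?thesis
    by (rule bij_betwI[where g = "\<lambda>v. (B y v, B x v, v - B y v *s x - B x v *s y)"])
      (auto simp: perp_def V_closed * bilinear)
qed

lemma card_V_hyperbolic:
  assumes "hyperbolic x y"
  shows "card V = CARD('a) ^ 2 * card (perp x y)"
  using bij_betw_same_card[OF hyperbolic_decomposition[OF assms]]
  by (simp add: card_cartesian_product power2_eq_square)

text \<open>For a unit \<open>a\<close> the map from \<open>b\<close> to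
  \<open>2 * (a * b) + c\<close> permutes the ring, so \<open>card P\<close> values of
  \<open>b\<close> qualify. For \<open>a\<close> in \<open>P\<close> the condition is just that
  \<open>c\<close> lies in \<open>P\<close>.\<close>

lemma card_hyperbolic_plane:
  "card {(a, b). 2 * (a * b) + c \<in> P} =
     card (- P) * card P + (if c \<in> P then card P * CARD('a) else 0)"
proof -
  have eq: "{(a, b). 2 * (a * b) + c \<in> P} = (SIGMA a:UNIV. {b. 2 * (a * b) + c \<in> P})" by auto
  have unit: "card {b. 2 * (a * b) + c \<in> P} = card P" if a: "a \<notin> P" for a
  proof -
    from a have "2 * a \<notin> P" by (simp add: mult_in_P_iff)
    then obtain v where v: "2 * a * v = 1" "v * (2 * a) = 1" by (rule unit_inverse)
    have 1: "v * (2 * (a * b)) = b" for b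
      using v(2) by (metis mult.assoc mult_1)
    have 2: "2 * (a * (v * t)) = t" for t
      using v(1) by (metis mult.assoc mult_1)
    have "bij_betw (\<lambda>b. 2 * (a * b) + c) {b. 2 * (a * b) + c \<in> P} P"
      by (rule bij_betwI[where g = "\<lambda>t. v * (t - c)"]) (auto simp: 1 2)
    then show ?thesis by (rule bij_betw_same_card)
  qed
  have nonunit: "{b. 2 * (a * b) + c \<in> P} = (if c \<in> P then UNIV else {})" if "a \<in> P" for a
    using that by (auto simp: add_in_P_iff' mult_in_P_iff)
  have "card {(a, b). 2 * (a * b) + c \<in> P} = (\<Sum>a\<in>UNIV. card {b. 2 * (a * b) + c \<in> P})"
    unfolding eq by (rule card_SigmaI) auto
  also have "\<dots> = (\<Sum>a\<in>- P. card {b. 2 * (a * b) + c \<in> P}) + (\<Sum>a\<in>P. card {b. 2 * (a * b) + c \<in> P})"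
    using sum.union_disjoint[of "- P" P "\<lambda>a. card {b. 2 * (a * b) + c \<in> P}"] by simp
  also have "\<dots> = card (- P) * card P + (if c \<in> P then card P * CARD('a) else 0)"
    by (simp add: unit nonunit)
  finally show ?thesis .
qed

text \<open>On \<open>a *s x + b *s y + w\<close> the quadratic form is
  \<open>2 * (a * b) + B w w\<close>, so each \<open>w\<close> contributes one count in the
  hyperbolic plane with \<open>c = B w w\<close>.\<close>

lemma card_singular_hyperbolic:
  assumes hyp: "hyperbolic x y"
  shows "card {v \<in> V. B v v \<in> P} =
    card (perp x y) * card (- P) * card P + card {w \<in> perp x y. B w w \<in> P} * card P * CARD('a)"
proof -
  let ?W = "perp x y"
  let ?g = "\<lambda>(a, b, w). a *s x + b *s y + w"
  note * = hyperbolicD[OF hyp]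
  have B_g: "B (a *s x + b *s y + w) (a *s x + b *s y + w) = 2 * (a * b) + B w w"
    if "w \<in> ?W" for a b w
    using * perpD[OF that] by (simp add: bilinear algebra_simps)
  have "bij_betw ?g {t \<in> UNIV \<times> UNIV \<times> ?W. B (?g t) (?g t) \<in> P} {v \<in> V. B v v \<in> P}"
    by (rule bij_betw_Collect[OF hyperbolic_decomposition[OF hyp]]) simp
  then have "card {v \<in> V. B v v \<in> P} = card {t \<in> UNIV \<times> UNIV \<times> ?W. B (?g t) (?g t) \<in> P}"
    by (rule bij_betw_same_card[symmetric])
  also have "\<dots> = card (SIGMA w:?W. {(a, b). 2 * (a * b) + B w w \<in> P})"
    by (rule bij_betw_same_card, rule bij_betwI[where f = "\<lambda>(a, b, w). (w, a, b)"
          and g = "\<lambda>(w, a, b). (a, b, w)"]) (auto simp: B_g)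
  also have "\<dots> = (\<Sum>w\<in>?W. card {(a, b). 2 * (a * b) + B w w \<in> P})"
    by (rule card_SigmaI) auto
  also have "\<dots> = card ?W * (card (- P) * card P) +
      (\<Sum>w\<in>?W. if B w w \<in> P then card P * CARD('a) else 0)"
    by (simp add: card_hyperbolic_plane sum.distrib)
  also have "(\<Sum>w\<in>?W. if B w w \<in> P then card P * CARD('a) else 0) =
      card {w \<in> ?W. B w w \<in> P} * (card P * CARD('a))"
    by (simp add: sum.If_cases Int_def)
  finally show ?thesis by (simp add: mult_ac)
qed

section \<open>Isotropic lines and their common neighbours\<close>

lemma line_scale: "v \<notin> P \<Longrightarrow> line (v *s x) = line x"
proof -
  assume "v \<notin> P"
  then obtain u where u: "v * u = 1" "u \<notin> P" by (rule unit_inverse)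
  have "line (v *s x) \<subseteq> line x"
    using \<open>v \<notin> P\<close> by (auto simp: line_def mult_in_P_iff intro!: imageI)
  moreover have "c *s x \<in> line (v *s x)" if "c \<notin> P" for c
  proof -
    have "c *s x = (c * u) *s (v *s x)"
      using u by (simp add: mult.assoc) (metis mult.commute mult_1_right)
    moreover have "c * u \<in> - P" using that u by (simp add: mult_in_P_iff)
    ultimately show ?thesis unfolding line_def by blast
  qed
  ultimately show ?thesis by (auto simp: line_def)
qed

lemma line_self: "x \<in> line x"
  unfolding line_def by (rule image_eqI[where x = 1]) auto

lemma line_subset_V: "x \<in> V \<Longrightarrow> line x \<subseteq> V"
  by (auto simp: line_def V_closed)

lemma isotropic_scale: "x \<in> isotropic \<Longrightarrow> v \<notin> P \<Longrightarrow> v *s x \<in> isotropic"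
  by (auto simp: isotropic_def primitive_def V_closed bilinear mult_in_P_iff)

lemma line_eqD:
  assumes "line x = line y" obtains u where "u \<notin> P" "x = u *s y"
  using assms line_self[of x] by (auto simp: line_def)

text \<open>Lines partition the isotropic vectors, and each has as many elements as there are units:
  pairing with a hyperbolic partner recovers the scalar.\<close>

lemma card_lines: "card (- P) * card (line ` isotropic) = card isotropic"
proof -
  have U: "\<Union> (line ` isotropic) = isotropic"
    using line_self isotropic_scale by (fastforce simp: line_def)
  have fin: "finite isotropic" using fin_V by (simp add: isotropic_def)
  have "card (- P) * card (line ` isotropic) = card (\<Union> (line ` isotropic))"
  proof (rule card_partition)
    show "finite (line ` isotropic)" "finite (\<Union> (line ` isotropic))" using fin U by auto
  next
    fix c assume "c \<in> line ` isotropic"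
    then obtain x where x: "x \<in> isotropic" "c = line x" by blast
    from x(1) obtain y where y: "B x y = 1" by (metis hyperbolic_exists hyperbolic_def)
    have "inj_on (\<lambda>u. u *s x) (- P)"
    proof (rule inj_onI)
      fix u v assume "u *s x = v *s x"
      then have "B (u *s x) y = B (v *s x) y" by simp
      then show "u = v" by (simp add: bilinear y)
    qed
    then show "card c = card (- P)" unfolding x(2) line_def by (rule card_image)
  next
    fix c d assume "c \<in> line ` isotropic" "d \<in> line ` isotropic" "c \<noteq> d"
    then obtain x y where xy: "c = line x" "d = line y" by blast
    have False if "t \<in> line x" "t \<in> line y" for t
    proof -
      from that obtain u v where "t = u *s x" "t = v *s y" "u \<notin> P" "v \<notin> P"
        unfolding line_def by blast
      then have "line t = line x" "line t = line y" by (metis line_scale)+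
      with xy \<open>c \<noteq> d\<close> show False by simp
    qed
    then show "c \<inter> d = {}" unfolding xy by blast
  qed
  then show ?thesis unfolding U .
qed

text \<open>
  A line not orthogonal to \<open>x\<close> modulo \<open>P\<close> has a unique representative pairing to \<open>1\<close> with \<open>x\<close>; its
  component along \<open>x\<close> is then forced by isotropy, so that it is determined by its component in the
  orthogonal complement of the hyperbolic pair.
\<close>

lemma card_common_neighbour_lines:
  assumes hyp: "hyperbolic x y"
  shows "card (line ` {t \<in> isotropic. B x t \<notin> P \<and> B z t \<notin> P}) =
    card {w \<in> perp x y. B z (y + w - (h * B w w) *s x) \<notin> P}"
proof -
  note * = hyperbolicD[OF hyp]
  define g where "g w = y + w - (h * B w w) *s x" for w
  let ?A = "{w \<in> perp x y. B z (g w) \<notin> P}"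
  let ?C = "{t \<in> isotropic. B x t \<notin> P \<and> B z t \<notin> P}"
  have g1: "B x (g w) = 1" "B (g w) x = 1" "B y (g w) = - (h * B w w)" if "w \<in> perp x y" for w
    using * perpD[OF that] by (simp_all add: g_def bilinear)
  have g: "g w \<in> isotropic" if w: "w \<in> perp x y" for w
  proof -
    have "B w w - h * B w w - h * B w w = 0"
      using half_add_half[of "B w w"] by (simp add: algebra_simps)
    then have "B (g w) (g w) = 0"
      using perpD[OF w] * by (simp add: g_def bilinear)
    moreover have "primitive (g w)"
      unfolding primitive_def using g1(2)[OF w] *(1) by (intro bexI[of _ x]) simp_all
    ultimately show ?thesis using w * by (simp add: isotropic_def g_def perp_def V_closed)
  qed
  have "line ` ?C = (\<lambda>w. line (g w)) ` ?A"
  proof (intro subset_antisym image_subsetI)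
    fix t assume t: "t \<in> ?C"
    then obtain v where v: "B x t * v = 1" "v * B x t = 1" "v \<notin> P" by (auto elim: unit_inverse)
    define s where "s = v *s t"
    have s: "s \<in> V" "B s s = 0" "B x s = 1" "B s x = 1" "B z s \<notin> P"
      using t v B_sym[of t x] by (auto simp: s_def isotropic_def V_closed bilinear mult_in_P_iff)
    define w where "w = s - B y s *s x - y"
    have w: "w \<in> perp x y" using s * by (simp add: perp_def w_def V_closed bilinear)
    \<comment> \<open>Expanding \<open>B w w\<close> with \<open>B s s = 0\<close> shows that the
      coefficient of \<open>x\<close> in \<open>s\<close>, namely \<open>B y s\<close>, is the one
      prescribed in \<open>g w\<close>.\<close>
    have "B w w = - (2 * B y s)"
      using s * B_sym[of s y] by (simp add: w_def bilinear)
    then have "h * B w w = - B y s" using two_half by (simp add: mult.commute flip: mult.assoc)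
    then have "g w = s" by (simp add: g_def w_def)
    moreover have "line s = line t" using v by (simp add: s_def line_scale)
    ultimately show "line t \<in> (\<lambda>w. line (g w)) ` ?A" using w s by (intro image_eqI[where x = w]) auto
  next
    fix w assume "w \<in> ?A"
    then show "line (g w) \<in> line ` ?C" using g g1 by auto
  qed
  moreover have "inj_on (\<lambda>w. line (g w)) ?A"
  proof (rule inj_onI)
    fix w w' assume w: "w \<in> ?A" "w' \<in> ?A" "line (g w) = line (g w')"
    then obtain u where u: "g w = u *s g w'" by (auto elim: line_eqD)
    \<comment> \<open>Pairing with \<open>x\<close> forces the scalar \<open>u\<close> to be 1;
      pairing with \<open>y\<close> then equates the coefficients of \<open>x\<close>, leaving
      \<open>w = w'\<close>.\<close>
    have "B x (g w) = u * B x (g w')" by (simp add: u bilinear)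
    then have "u = 1" using w g1(1)[of w] g1(1)[of w'] by simp
    then have "g w = g w'" using u by simp
    moreover from this have "h * B w w = h * B w' w'" using w g1(3)[of w] g1(3)[of w'] by simp
    ultimately show "w = w'" by (simp add: g_def)
  qed
  ultimately show ?thesis unfolding g_def by (simp add: card_image)
qed

text \<open>Take \<open>z = x\<close> in the preceding count: the representative pairs to 1 with
  \<open>x\<close>, so no \<open>w\<close> is excluded.\<close>

lemma card_neighbour_lines:
  assumes "hyperbolic x y"
  shows "card (line ` {t \<in> isotropic. B x t \<notin> P}) = card (perp x y)"
proof -
  have "{w \<in> perp x y. B x (y + w - (h * B w w) *s x) \<notin> P} = perp x y"
    using assms by (auto simp: perp_def hyperbolic_def bilinear)
  then show ?thesis using card_common_neighbour_lines[OF assms, of x] by simp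
qed

text \<open>The second member of the hyperbolic pair is \<open>y\<close> itself up to the unit
  \<open>v\<close>, and it pairs with the representative of \<open>w\<close> to
  \<open>- (h * B w w)\<close>, which is a unit exactly when \<open>B w w\<close> is.\<close>

lemma card_common_neighbour_lines_adjacent:
  assumes hyp: "hyperbolic x (v *s y)" and v: "v \<notin> P"
  shows "card (line ` {t \<in> isotropic. B x t \<notin> P \<and> B y t \<notin> P}) =
    card {w \<in> perp x (v *s y). B w w \<notin> P}"
proof -
  have "B y (v *s y + w - (h * B w w) *s x) \<notin> P \<longleftrightarrow> B w w \<notin> P" if w: "w \<in> perp x (v *s y)" for w
  proof -
    have "v * B y (v *s y + w - (h * B w w) *s x) = - (h * B w w)"
      using w hyp B_sym[of "v *s y" x]
      by (simp add: perp_def hyperbolic_def flip: B_scale_left) (simp add: bilinear)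
    then have "v * B y (v *s y + w - (h * B w w) *s x) \<notin> P \<longleftrightarrow> B w w \<notin> P"
      by (simp add: mult_in_P_iff)
    then show ?thesis using v by (simp add: mult_in_P_iff)
  qed
  then have "{w \<in> perp x (v *s y). B y (v *s y + w - (h * B w w) *s x) \<notin> P} =
      {w \<in> perp x (v *s y). B w w \<notin> P}" by blast
  then show ?thesis using card_common_neighbour_lines[OF hyp] by simp
qed

text \<open>
  For non-adjacent \<open>x\<close> and \<open>z\<close> the condition becomes affine modulo \<open>P\<close>: either its linear part
  vanishes (\<open>z\<close> is then a multiple of \<open>x\<close> modulo \<open>P\<close>), or it is equidistributed.
\<close>

lemma card_common_neighbour_lines_nonadjacent:
  assumes hyp: "hyperbolic x y" and z: "z \<in> isotropic" and xz: "B x z \<in> P"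
  defines "N \<equiv> card (line ` {t \<in> isotropic. B x t \<notin> P \<and> B z t \<notin> P})"
  shows "N = card (perp x y) \<or> N * CARD('a) = card (perp x y) * card (- P)"
proof -
  note * = hyperbolicD[OF hyp]
  define c where "c = B y z"
  define v where "v = z - c *s x - B x z *s y"
  have zV: "z \<in> V" using z by (simp add: isotropic_def)
  have v: "v \<in> perp x y" using * zV by (simp add: perp_def v_def V_closed bilinear c_def)
  have z_eq: "z = c *s x + B x z *s y + v" by (simp add: v_def)
  \<comment> \<open>Non-adjacency puts the quadratic term \<open>h * B w w * B x z\<close> into
    \<open>P\<close>, which leaves an affine condition on \<open>w\<close>.\<close>
  have unit_iff: "B z (y + w - (h * B w w) *s x) \<notin> P \<longleftrightarrow> c + B v w \<notin> P" if w: "w \<in> perp x y" for w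
  proof -
    have "B z w = B v w" using w by (simp add: v_def perp_def bilinear)
    then have "B z (y + w - (h * B w w) *s x) = (c + B v w) - h * B w w * B x z"
      using B_sym[of z x] B_sym[of z y] by (simp add: c_def bilinear)
    then show ?thesis using xz by (simp add: diff_in_P_iff mult_in_P_iff)
  qed
  have N: "N = card {w \<in> perp x y. c + B v w \<notin> P}"
    unfolding N_def card_common_neighbour_lines[OF hyp] using unit_iff
    by (metis (mono_tags, lifting) Collect_cong)
  show ?thesis
  proof (cases "primitive v")
    case False
    then have vP: "B v t \<in> P" if "t \<in> V" for t using that by (auto simp: primitive_def)
    from z obtain t where t: "t \<in> V" "B z t \<notin> P" by (auto simp: isotropic_def primitive_def)
    \<comment> \<open>In the unit \<open>B z t\<close> only \<open>c * B x t\<close> survives modulo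
      \<open>P\<close>, so \<open>c\<close> is a unit and the condition holds for every
      \<open>w\<close>.\<close>
    have "B z t = c * B x t + (B x z * B y t + B v t)"
      by (subst z_eq) (simp add: bilinear add.assoc)
    moreover have "B x z * B y t + B v t \<in> P" using xz vP t by (simp add: P_add mult_in_P_iff)
    ultimately have "c \<notin> P" using t by (auto simp: add_in_P_iff mult_in_P_iff)
    then have "{w \<in> perp x y. c + B v w \<notin> P} = perp x y"
      using vP by (auto simp: perp_def add_in_P_iff)
    then show ?thesis using N by simp
  next
    case True
    then obtain t where t: "t \<in> V" "B v t \<notin> P" by (auto simp: primitive_def)
    then obtain u where u: "u * B v t = 1" by (auto elim: unit_inverse)
    \<comment> \<open>Project \<open>t\<close> into the complement. Since \<open>v\<close> is
      orthogonal to \<open>x\<close> and \<open>y\<close>, its pairing with \<open>t'\<close> is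
      still a unit, so the multiples of \<open>t'\<close> already make \<open>B v\<close>
      surjective.\<close>
    define t' where "t' = t - B y t *s x - B x t *s y"
    have t': "t' \<in> perp x y" using * t by (simp add: perp_def t'_def V_closed bilinear)
    have Bvt': "B v t' = B v t"
      using v B_sym[of v x] B_sym[of v y] by (simp add: t'_def perp_def bilinear)
    have surj: "B v ` perp x y = UNIV"
    proof (intro equalityI subset_UNIV subsetI)
      fix r
      have "(r * u) *s t' \<in> perp x y" using t' by (simp add: perp_def V_closed bilinear)
      moreover have "B v ((r * u) *s t') = r" using u by (simp add: bilinear Bvt' mult.assoc)
      ultimately show "r \<in> B v ` perp x y" by (metis imageI)
    qed
    have "card {w \<in> perp x y. B v w \<in> (\<lambda>r. r - c) ` (- P)} * card (B v ` perp x y) =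
        card (perp x y) * card ((\<lambda>r. r - c) ` (- P))"
      by (rule card_preimage_additive)
        (use surj v fin_V in \<open>auto simp: bilinear V_closed perp_def\<close>)
    moreover have "card ((\<lambda>r. r - c) ` (- P)) = card (- P)"
      by (intro card_image inj_onI) simp
    moreover have "B v w \<in> (\<lambda>r. r - c) ` (- P) \<longleftrightarrow> c + B v w \<notin> P" for w
      by (auto simp: image_iff algebra_simps)
    ultimately show ?thesis using N surj by simp
  qed
qed

end

section \<open>The space in coordinates\<close>

text \<open>Vectors are encoded as functions vanishing outside an index set, so that pointwise
  addition is available on the whole type and a vector is the sum of its coordinate blocks. The
  entry set \<open>J\<close> will be \<open>UNIV\<close> or \<open>P\<close>.\<close>

definition supported_funs :: "nat set \<Rightarrow> 'a set \<Rightarrow> (nat \<Rightarrow> 'a::zero) set" where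
  "supported_funs I J = {x. (\<forall>i\<in>I. x i \<in> J) \<and> (\<forall>i. i \<notin> I \<longrightarrow> x i = 0)}"

definition cut :: "nat set \<Rightarrow> (nat \<Rightarrow> 'a::zero) \<Rightarrow> nat \<Rightarrow> 'a" where
  "cut I x = (\<lambda>i. if i \<in> I then x i else 0)"

lemma bij_betw_supported_funs_PiE:
  "bij_betw (\<lambda>x. restrict x I) (supported_funs I J) (PiE I (\<lambda>_. J))"
  by (rule bij_betwI[where g = "cut I"])
    (auto simp: supported_funs_def cut_def PiE_def extensional_def fun_eq_iff)

lemma card_supported_funs: "finite I \<Longrightarrow> card (supported_funs I J) = card J ^ card I"
  using bij_betw_same_card[OF bij_betw_supported_funs_PiE, of I J] by (simp add: card_PiE)

lemma finite_supported_funs: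
  "finite I \<Longrightarrow> finite (J :: 'a::zero set) \<Longrightarrow> finite (supported_funs I J)"
  using bij_betw_finite[OF bij_betw_supported_funs_PiE, of I J] by (simp add: finite_PiE)

lemma supported_funs_mono: "J \<subseteq> K \<Longrightarrow> supported_funs I J \<subseteq> supported_funs I K"
  by (auto simp: supported_funs_def)

context odd_local_ring
begin

text \<open>Here \<open>J\<close> is an ideal. A unit coefficient makes the linear form map the
  vectors with entries in \<open>J\<close> onto \<open>J\<close>, so all its fibres over
  \<open>J\<close> have the same size.\<close>

lemma card_linear_form:
  assumes fin: "finite I" and k: "k \<in> I" "b k \<notin> P"
    and J: "0 \<in> J" "\<And>x y. x \<in> J \<Longrightarrow> y \<in> J \<Longrightarrow> x - y \<in> J" "\<And>x c. x \<in> J \<Longrightarrow> c * x \<in> J"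
    and T: "T \<subseteq> J"
  shows "card {a \<in> supported_funs I J. (\<Sum>i\<in>I. b i * a i) \<in> T} * card J = card J ^ card I * card T"
proof -
  have add: "x + y \<in> J" if "x \<in> J" "y \<in> J" for x y
    using J(2)[OF that(1) J(2)[OF J(1) that(2)]] by simp
  have sum: "sum g A \<in> J" if "\<And>i. i \<in> A \<Longrightarrow> g i \<in> J" for g :: "nat \<Rightarrow> 'a" and A
    using that by (induction A rule: infinite_finite_induct) (auto intro: add J(1))
  let ?\<phi> = "\<lambda>a. \<Sum>i\<in>I. b i * a i"
  have image: "?\<phi> ` supported_funs I J = J"
  proof (intro equalityI subsetI)
    fix t assume "t \<in> ?\<phi> ` supported_funs I J"
    then show "t \<in> J" by (auto simp: supported_funs_def intro!: sum J(3))
  next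
    fix t assume t: "t \<in> J"
    from k(2) obtain v where v: "b k * v = 1" by (rule unit_inverse)
    let ?a = "\<lambda>i. if i = k then v * t else 0"
    have "?a \<in> supported_funs I J" using k t J by (auto simp: supported_funs_def)
    moreover have "?\<phi> ?a = (\<Sum>i\<in>I. if i = k then t else 0)"
      by (rule sum.cong) (use v in \<open>auto simp flip: mult.assoc\<close>)
    ultimately show "t \<in> ?\<phi> ` supported_funs I J"
      using k fin by (intro image_eqI[where x = ?a]) simp_all
  qed
  have "(\<lambda>_. 0) \<in> supported_funs I J" using J by (simp add: supported_funs_def)
  then have "card {a \<in> supported_funs I J. ?\<phi> a \<in> T} * card (?\<phi> ` supported_funs I J) =
      card (supported_funs I J) * card T"
    using T image J
    by (intro card_preimage_additive finite_supported_funs fin)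
      (auto simp: supported_funs_def right_diff_distrib sum_subtractf)
  then show ?thesis using image fin by (simp add: card_supported_funs)
qed

lemma card_affine_form:
  assumes "finite I" "k \<in> I" "b k \<notin> P"
    and "0 \<in> J" "\<And>x y. x \<in> J \<Longrightarrow> y \<in> J \<Longrightarrow> x - y \<in> J" "\<And>x c. x \<in> J \<Longrightarrow> c * x \<in> J"
    and "T \<subseteq> J" "c \<in> J"
  shows "card {a \<in> supported_funs I J. (\<Sum>i\<in>I. b i * a i) + c \<in> T} = card J ^ (card I - 1) * card T"
proof -
  \<comment> \<open>The constant \<open>c\<close> is absorbed by translating the target, which stays
    inside \<open>J\<close>.\<close>
  let ?T = "(\<lambda>t. t - c) ` T"
  have "?T \<subseteq> J" using assms by auto
  moreover have "card ?T = card T" by (intro card_image inj_onI) simp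
  moreover have "s \<in> ?T \<longleftrightarrow> s + c \<in> T" for s by force
  ultimately have "card {a \<in> supported_funs I J. (\<Sum>i\<in>I. b i * a i) + c \<in> T} * card J =
      card J ^ card I * card T"
    using card_linear_form[of I k b J ?T] assms by simp
  moreover have "card I > 0" using assms(1,2) by (auto simp: card_gt_0_iff)
  then obtain n where "card I = Suc n" using gr0_implies_Suc by blast
  moreover have "card J \<noteq> 0" using \<open>0 \<in> J\<close> by auto
  ultimately show ?thesis by simp
qed

end

text \<open>The coefficients \<open>d\<close> are the diagonal of \<open>\<Delta>\<close>, and the
  last assumption says that this block is anisotropic modulo \<open>P\<close>.\<close>

locale orthogonal_space = odd_local_ring P h
  for P :: "'a::{finite, comm_ring_1} set" and h :: 'a +
  fixes \<nu> \<delta> :: nat and d :: "nat \<Rightarrow> 'a"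
  assumes \<nu>: "\<nu> > 0"
    and d_unit: "j < \<delta> \<Longrightarrow> d j \<notin> P"
    and anisotropic: "(\<Sum>j<\<delta>. d j * x j * x j) \<in> P \<Longrightarrow> j < \<delta> \<Longrightarrow> x j \<in> P"
begin

definition form :: "(nat \<Rightarrow> 'a) \<Rightarrow> (nat \<Rightarrow> 'a) \<Rightarrow> 'a" where
  "form x y = (\<Sum>i<\<nu>. x i * y (\<nu> + i) + x (\<nu> + i) * y i) +
     (\<Sum>j<\<delta>. d j * x (2 * \<nu> + j) * y (2 * \<nu> + j))"

definition scal :: "'a \<Rightarrow> (nat \<Rightarrow> 'a) \<Rightarrow> nat \<Rightarrow> 'a" where
  "scal c x = (\<lambda>i. c * x i)"

abbreviation "space \<equiv> supported_funs {..<2 * \<nu> + \<delta>} (UNIV :: 'a set)"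

sublocale quadratic_module P h scal space form
proof (unfold_locales)
  show "scal a (x + y) = scal a x + scal a y" "scal (a + b) x = scal a x + scal b x"
    "scal a (scal b x) = scal (a * b) x" "scal 1 x = x" for a b x y
    by (simp_all add: scal_def fun_eq_iff algebra_simps)
  then interpret Modules.module scal by unfold_locales
  show "subspace space" by (auto simp: subspace_def supported_funs_def scal_def)
  show "finite space" by (simp add: finite_supported_funs)
  show "form (x + y) w = form x w + form y w" for x y w
    by (simp add: form_def algebra_simps sum.distrib)
  show "form (scal c x) w = c * form x w" for c x w
    by (simp add: form_def scal_def algebra_simps sum_distrib_left)
  show "form x y = form y x" for x y
    by (simp add: form_def algebra_simps)
qed

text \<open>A coordinate is read off by pairing with the basis vector of the hyperbolic partner
  index, or on the diagonal block with its own basis vector, up to the unit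
  \<open>d\<close>.\<close>

lemma form_basis:
  assumes "k < 2 * \<nu> + \<delta>"
  obtains y c where "y \<in> space" "c \<notin> P" "\<And>x. form x y = c * x k"
proof -
  let ?e = "\<lambda>k i. if i = k then 1 else 0 :: 'a"
  have e: "?e i \<in> space" if "i < 2 * \<nu> + \<delta>" for i
    using that by (auto simp: supported_funs_def)
  consider "k < \<nu>" | "\<nu> \<le> k" "k < 2 * \<nu>" | "2 * \<nu> \<le> k" by linarith
  then show thesis
  proof cases
    case 1
    have "form x (?e (\<nu> + k)) = (\<Sum>i<\<nu>. if i = k then x i else 0) + (\<Sum>j<\<delta>. 0)" for x
      unfolding form_def by (rule arg_cong2[of _ _ _ _ "(+)"]; rule sum.cong) (use 1 in auto)
    then have "form x (?e (\<nu> + k)) = 1 * x k" for x using 1 by simp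
    then show thesis using 1 by (intro that[OF e[of "\<nu> + k"] one_notin_P]) auto
  next
    case 2
    have "form x (?e (k - \<nu>)) = (\<Sum>i<\<nu>. if i = k - \<nu> then x (\<nu> + i) else 0) + (\<Sum>j<\<delta>. 0)" for x
      unfolding form_def by (rule arg_cong2[of _ _ _ _ "(+)"]; rule sum.cong) (use 2 in auto)
    then have "form x (?e (k - \<nu>)) = 1 * x k" for x using 2 by simp
    then show thesis using 2 by (intro that[OF e[of "k - \<nu>"] one_notin_P]) auto
  next
    case 3
    have "form x (?e k) = (\<Sum>i<\<nu>. 0) + (\<Sum>j<\<delta>. if j = k - 2 * \<nu> then d j * x (2 * \<nu> + j) else 0)" for x
      unfolding form_def by (rule arg_cong2[of _ _ _ _ "(+)"]; rule sum.cong) (use 3 in auto)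
    then have "form x (?e k) = d (k - 2 * \<nu>) * x k" for x using 3 assms by simp
    then show thesis using 3 assms d_unit by (intro that[OF e[of k]]) auto
  qed
qed

lemma primitive_iff: "primitive x \<longleftrightarrow> (\<exists>i<2 * \<nu> + \<delta>. x i \<notin> P)"
proof
  assume "primitive x"
  then obtain y where y: "form x y \<notin> P" by (auto simp: primitive_def)
  show "\<exists>i<2 * \<nu> + \<delta>. x i \<notin> P"
  proof (rule ccontr)
    assume "\<not> ?thesis"
    then have "form x y \<in> P"
      unfolding form_def by (auto intro!: P_add P_sum simp: mult_in_P_iff)
    with y show False ..
  qed
next
  assume "\<exists>i<2 * \<nu> + \<delta>. x i \<notin> P"
  then obtain k where "k < 2 * \<nu> + \<delta>" "x k \<notin> P" by blast
  with form_basis[of k] show "primitive x"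
    unfolding primitive_def by (metis mult_in_P_iff)
qed

section \<open>Counting vectors by coordinate blocks\<close>

definition I1 :: "nat set" where "I1 = {..<\<nu>}"
definition I2 :: "nat set" where "I2 = {\<nu>..<2 * \<nu>}"
definition I3 :: "nat set" where "I3 = {2 * \<nu>..<2 * \<nu> + \<delta>}"

lemma I_props [simp]: "finite I1" "finite I2" "finite I3" "card I1 = \<nu>" "card I2 = \<nu>" "card I3 = \<delta>"
  by (simp_all add: I1_def I2_def I3_def)

abbreviation F1 :: "'a set \<Rightarrow> (nat \<Rightarrow> 'a) set" where "F1 \<equiv> supported_funs I1"
abbreviation F2 :: "'a set \<Rightarrow> (nat \<Rightarrow> 'a) set" where "F2 \<equiv> supported_funs I2"
abbreviation F3 :: "'a set \<Rightarrow> (nat \<Rightarrow> 'a) set" where "F3 \<equiv> supported_funs I3"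

lemma cut_sum:
  assumes "a \<in> F1 UNIV" "b \<in> F2 UNIV" "c \<in> F3 UNIV"
  shows "cut I1 (a + b + c) = a" "cut I2 (a + b + c) = b" "cut I3 (a + b + c) = c"
  using assms by (auto simp: cut_def supported_funs_def I1_def I2_def I3_def fun_eq_iff)

lemma sum_cut:
  assumes "x \<in> space" shows "cut I1 x + cut I2 x + cut I3 x = x"
  using assms by (auto simp: cut_def supported_funs_def I1_def I2_def I3_def fun_eq_iff)

lemma sum_in_space:
  assumes "a \<in> F1 UNIV" "b \<in> F2 UNIV" "c \<in> F3 UNIV"
  shows "a + b + c \<in> space"
  using assms by (auto simp: supported_funs_def I1_def I2_def I3_def)

lemma cut_in: "cut I x \<in> supported_funs I J \<longleftrightarrow> (\<forall>i\<in>I. x i \<in> J)"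
  by (auto simp: cut_def supported_funs_def)

lemma cut_in_UNIV: "cut I x \<in> supported_funs I UNIV"
  by (simp add: cut_in)

definition Q3 :: "(nat \<Rightarrow> 'a) \<Rightarrow> 'a" where
  "Q3 c = (\<Sum>j<\<delta>. d j * c (2 * \<nu> + j) * c (2 * \<nu> + j))"

text \<open>For fixed \<open>b\<close> and \<open>c\<close> the quadratic form is affine in
  \<open>a\<close>, which is the shape needed for \<open>card_affine_form\<close>;
  \<open>form_sum2\<close> exchanges \<open>a\<close> and \<open>b\<close>.\<close>

lemma form_sum1:
  assumes "a \<in> F1 UNIV" "b \<in> F2 UNIV" "c \<in> F3 UNIV"
  shows "form (a + b + c) (a + b + c) = (\<Sum>i\<in>I1. (2 * b (\<nu> + i)) * a i) + Q3 c"
proof -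
  have 1: "(a + b + c) i = a i" "(a + b + c) (\<nu> + i) = b (\<nu> + i)" if "i < \<nu>" for i
    using assms that by (auto simp: supported_funs_def I1_def I2_def I3_def)
  have 2: "(a + b + c) (2 * \<nu> + j) = c (2 * \<nu> + j)" for j
    using assms by (auto simp: supported_funs_def I1_def I2_def I3_def)
  have "(\<Sum>i<\<nu>. (a + b + c) i * (a + b + c) (\<nu> + i) + (a + b + c) (\<nu> + i) * (a + b + c) i) =
      (\<Sum>i<\<nu>. (2 * b (\<nu> + i)) * a i)"
    by (rule sum.cong) (use 1 in \<open>simp_all only: lessThan_iff, simp add: algebra_simps\<close>)
  then show ?thesis unfolding form_def Q3_def 2 I1_def by simp
qed

lemma form_sum2:
  assumes "a \<in> F1 UNIV" "b \<in> F2 UNIV" "c \<in> F3 UNIV"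
  shows "form (a + b + c) (a + b + c) = (\<Sum>i\<in>I2. (2 * a (i - \<nu>)) * b i) + Q3 c"
proof -
  have "(\<Sum>i\<in>I1. (2 * b (\<nu> + i)) * a i) = (\<Sum>i\<in>I2. (2 * a (i - \<nu>)) * b i)"
    by (rule sum.reindex_bij_witness[where i = "\<lambda>i. i - \<nu>" and j = "\<lambda>i. \<nu> + i"])
      (auto simp: I1_def I2_def)
  then show ?thesis using form_sum1[OF assms] by simp
qed

lemma Q3_in_P_iff:
  assumes "c \<in> F3 UNIV" shows "Q3 c \<in> P \<longleftrightarrow> c \<in> F3 P"
proof
  assume "Q3 c \<in> P"
  then have "c (2 * \<nu> + j) \<in> P" if "j < \<delta>" for j
    using anisotropic[of "\<lambda>j. c (2 * \<nu> + j)" j] that by (simp add: Q3_def)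
  then have "c i \<in> P" if "i \<in> I3" for i
    using that by (auto simp: I3_def dest!: le_Suc_ex)
  then show "c \<in> F3 P" using assms by (auto simp: supported_funs_def)
next
  assume "c \<in> F3 P"
  then show "Q3 c \<in> P"
    by (auto simp: Q3_def supported_funs_def I3_def mult_in_P_iff intro!: P_sum)
qed

lemma F_UNIV: "a \<in> supported_funs I P \<Longrightarrow> a \<in> supported_funs I UNIV"
  using supported_funs_mono[of P UNIV] by blast

lemma card_F_diff: "finite I \<Longrightarrow>
    card (supported_funs I UNIV - supported_funs I P) = CARD('a) ^ card I - card P ^ card I"
  using supported_funs_mono[of P UNIV I]
  by (simp add: card_Diff_subset finite_supported_funs card_supported_funs)

text \<open>Fix \<open>a\<close> with a unit entry and any \<open>c\<close>. The form is then affine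
  in \<open>b\<close> with a unit coefficient, so every value is taken
  \<open>CARD('a) ^ (\<nu> - 1)\<close> times.\<close>

lemma card_form_values_unit_I1:
  "card {x \<in> space. form x x \<in> T \<and> (\<exists>i\<in>I1. x i \<notin> P)} =
    (CARD('a) ^ \<nu> - card P ^ \<nu>) * CARD('a) ^ \<delta> * (CARD('a) ^ (\<nu> - 1) * card T)"
proof -
  let ?A = "(F1 UNIV - F1 P) \<times> F3 UNIV"
  let ?f = "\<lambda>((a, c), b). a + b + c"
  have "{x \<in> space. form x x \<in> T \<and> (\<exists>i\<in>I1. x i \<notin> P)} =
      {x \<in> space. form x x \<in> T \<and> cut I1 x \<notin> F1 P}" by (simp add: cut_in)
  also have "card \<dots> = card (SIGMA (a, c):?A. {b \<in> F2 UNIV. form (a + b + c) (a + b + c) \<in> T})"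
    by (rule bij_betw_same_card[symmetric], rule bij_betwI[where f = ?f
          and g = "\<lambda>x. ((cut I1 x, cut I3 x), cut I2 x)"])
      (auto simp: cut_sum sum_cut sum_in_space cut_in_UNIV)
  also have "\<dots> = (\<Sum>(a, c)\<in>?A. card {b \<in> F2 UNIV. form (a + b + c) (a + b + c) \<in> T})"
    by (subst card_SigmaI) (auto simp: finite_supported_funs case_prod_unfold)
  also have "\<dots> = (\<Sum>(a, c)\<in>?A. CARD('a) ^ (\<nu> - 1) * card T)"
  proof (rule sum.cong[OF refl], clarify)
    fix a c assume ac: "a \<in> F1 UNIV" "a \<notin> F1 P" "c \<in> F3 UNIV"
    then obtain i where i: "i \<in> I1" "a i \<notin> P" by (auto simp: supported_funs_def)
    have "{b \<in> F2 UNIV. form (a + b + c) (a + b + c) \<in> T} =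
        {b \<in> F2 UNIV. (\<Sum>i\<in>I2. (2 * a (i - \<nu>)) * b i) + Q3 c \<in> T}"
      using form_sum2[OF ac(1) _ ac(3)] by auto
    also have "card \<dots> = CARD('a) ^ (\<nu> - 1) * card T"
      using card_affine_form[of I2 "\<nu> + i" "\<lambda>i. 2 * a (i - \<nu>)" UNIV T "Q3 c"] i
      by (simp add: mult_in_P_iff) (simp add: I1_def I2_def)
    finally show "card {b \<in> F2 UNIV. form (a + b + c) (a + b + c) \<in> T} = CARD('a) ^ (\<nu> - 1) * card T" .
  qed
  also have "\<dots> = card ?A * (CARD('a) ^ (\<nu> - 1) * card T)" by (simp add: case_prod_unfold)
  also have "card ?A = (CARD('a) ^ \<nu> - card P ^ \<nu>) * CARD('a) ^ \<delta>"
    by (simp add: card_cartesian_product card_F_diff card_supported_funs)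
  finally show ?thesis .
qed

text \<open>Vectors with a unit in the first block are counted above. If the first block lies in
  \<open>P\<close>, the bilinear part does too, so anisotropy forces the third block into
  \<open>P\<close> while the second is free.\<close>

lemma card_singular:
  "card {x \<in> space. form x x \<in> P} =
    (CARD('a) ^ \<nu> - card P ^ \<nu>) * CARD('a) ^ \<delta> * (CARD('a) ^ (\<nu> - 1) * card P) +
    card P ^ \<nu> * CARD('a) ^ \<nu> * card P ^ \<delta>"
proof -
  let ?X = "{x \<in> space. form x x \<in> P \<and> (\<exists>i\<in>I1. x i \<notin> P)}"
  let ?Y = "{x \<in> space. form x x \<in> P \<and> (\<forall>i\<in>I1. x i \<in> P)}"
  have form_P: "form (a + b + c) (a + b + c) \<in> P \<longleftrightarrow> c \<in> F3 P"
    if "a \<in> F1 P" "b \<in> F2 UNIV" "c \<in> F3 UNIV" for a b c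
  proof -
    have "(\<Sum>i\<in>I1. (2 * b (\<nu> + i)) * a i) \<in> P"
      using that by (auto simp: supported_funs_def mult_in_P_iff intro!: P_sum)
    then show ?thesis
      using that by (simp add: form_sum1 F_UNIV add_in_P_iff' Q3_in_P_iff)
  qed
  have "bij_betw (\<lambda>(a, b, c). a + b + c) (F1 P \<times> F2 UNIV \<times> F3 P) ?Y"
  proof (rule bij_betwI[where g = "\<lambda>x. (cut I1 x, cut I2 x, cut I3 x)"])
    show "(\<lambda>(a, b, c). a + b + c) \<in> F1 P \<times> F2 UNIV \<times> F3 P \<rightarrow> ?Y"
    proof clarsimp
      fix a b c assume abc: "a \<in> F1 P" "b \<in> F2 UNIV" "c \<in> F3 P"
      then have "cut I1 (a + b + c) \<in> F1 P" by (simp add: cut_sum F_UNIV)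
      then show "a + b + c \<in> space \<and> form (a + b + c) (a + b + c) \<in> P \<and>
          (\<forall>i\<in>I1. a i + b i + c i \<in> P)"
        using abc by (simp add: sum_in_space form_P F_UNIV cut_in)
    qed
    show "(\<lambda>x. (cut I1 x, cut I2 x, cut I3 x)) \<in> ?Y \<rightarrow> F1 P \<times> F2 UNIV \<times> F3 P"
    proof
      fix x assume x: "x \<in> ?Y"
      then have "cut I1 x \<in> F1 P" "cut I2 x \<in> F2 UNIV" "cut I3 x \<in> F3 UNIV" by (auto simp: cut_in)
      with form_P[OF this] x show "(cut I1 x, cut I2 x, cut I3 x) \<in> F1 P \<times> F2 UNIV \<times> F3 P"
        by (simp add: sum_cut)
    qed
  qed (auto simp: cut_sum sum_cut F_UNIV)
  then have Y: "card ?Y = card P ^ \<nu> * CARD('a) ^ \<nu> * card P ^ \<delta>"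
    by (simp add: bij_betw_same_card[symmetric] card_cartesian_product card_supported_funs)
  have XY: "{x \<in> space. form x x \<in> P} = ?X \<union> ?Y" by auto
  have "card (?X \<union> ?Y) = card ?X + card ?Y"
    by (rule card_Un_disjoint) (auto simp: finite_supported_funs)
  then show ?thesis by (simp only: XY Y card_form_values_unit_I1)
qed

text \<open>If the first block lies in \<open>P\<close>, anisotropy puts the third into
  \<open>P\<close>, and primitivity then demands a unit in the second. The equation is now affine in
  \<open>a\<close> with a unit coefficient, all values lying in \<open>P\<close>; hence
  \<open>card_affine_form\<close> with \<open>J = P\<close>, giving
  \<open>card P ^ (\<nu> - 1)\<close> solutions.\<close>

lemma card_isotropic:
  "card isotropic =
    (CARD('a) ^ \<nu> - card P ^ \<nu>) * CARD('a) ^ (\<delta> + \<nu> - 1) +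
    (CARD('a) ^ \<nu> - card P ^ \<nu>) * card P ^ (\<delta> + \<nu> - 1)"
proof -
  let ?X = "{x \<in> space. form x x \<in> {0} \<and> (\<exists>i\<in>I1. x i \<notin> P)}"
  let ?Y = "{x \<in> space. form x x = 0 \<and> (\<forall>i\<in>I1. x i \<in> P) \<and> (\<exists>i\<in>I2. x i \<notin> P)}"
  have Q3_P: "c \<in> F3 P" if "a \<in> F1 P" "b \<in> F2 UNIV" "c \<in> F3 UNIV"
    "form (a + b + c) (a + b + c) = 0" for a b c
  proof -
    have "(\<Sum>i\<in>I1. (2 * b (\<nu> + i)) * a i) \<in> P"
      using that by (auto simp: supported_funs_def mult_in_P_iff intro!: P_sum)
    moreover have "(\<Sum>i\<in>I1. (2 * b (\<nu> + i)) * a i) + Q3 c \<in> P"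
      using that form_sum1[of a b c] by (simp add: F_UNIV)
    ultimately show ?thesis using that by (simp add: add_in_P_iff' Q3_in_P_iff)
  qed
  let ?A = "(F2 UNIV - F2 P) \<times> F3 P"
  have "bij_betw (\<lambda>((b, c), a). a + b + c)
      (SIGMA (b, c):?A. {a \<in> F1 P. form (a + b + c) (a + b + c) = 0}) ?Y"
  proof (rule bij_betwI[where g = "\<lambda>x. ((cut I2 x, cut I3 x), cut I1 x)"])
    show "(\<lambda>((b, c), a). a + b + c) \<in>
        (SIGMA (b, c):?A. {a \<in> F1 P. form (a + b + c) (a + b + c) = 0}) \<rightarrow> ?Y"
    proof clarsimp
      fix a b c assume abc: "b \<in> F2 UNIV" "b \<notin> F2 P" "c \<in> F3 P" "a \<in> F1 P"
      then have "cut I1 (a + b + c) \<in> F1 P" "cut I2 (a + b + c) \<notin> F2 P"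
        by (simp_all add: cut_sum F_UNIV)
      then show "a + b + c \<in> space \<and> (\<forall>i\<in>I1. a i + b i + c i \<in> P) \<and>
          (\<exists>i\<in>I2. a i + b i + c i \<notin> P)"
        using abc by (simp add: sum_in_space F_UNIV cut_in)
    qed
    show "(\<lambda>x. ((cut I2 x, cut I3 x), cut I1 x)) \<in> ?Y \<rightarrow>
        (SIGMA (b, c):?A. {a \<in> F1 P. form (a + b + c) (a + b + c) = 0})"
    proof
      fix x assume x: "x \<in> ?Y"
      then have *: "cut I1 x \<in> F1 P" "cut I2 x \<in> F2 UNIV" "cut I3 x \<in> F3 UNIV" "cut I2 x \<notin> F2 P"
        by (auto simp: cut_in)
      with Q3_P[OF *(1-3)] x show "((cut I2 x, cut I3 x), cut I1 x) \<in>
          (SIGMA (b, c):?A. {a \<in> F1 P. form (a + b + c) (a + b + c) = 0})"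
        by (simp add: sum_cut)
    qed
  qed (auto simp: cut_sum sum_cut F_UNIV)
  then have "card ?Y = card (SIGMA (b, c):?A. {a \<in> F1 P. form (a + b + c) (a + b + c) = 0})"
    by (rule bij_betw_same_card[symmetric])
  also have "\<dots> = (\<Sum>(b, c)\<in>?A. card {a \<in> F1 P. form (a + b + c) (a + b + c) = 0})"
    by (subst card_SigmaI) (auto simp: finite_supported_funs case_prod_unfold)
  also have "\<dots> = (\<Sum>(b, c)\<in>?A. card P ^ (\<nu> - 1))"
  proof (rule sum.cong[OF refl], clarify)
    fix b c assume bc: "b \<in> F2 UNIV" "b \<notin> F2 P" "c \<in> F3 P"
    then obtain i where i: "i \<in> I2" "b i \<notin> P" by (auto simp: supported_funs_def)
    have "{a \<in> F1 P. form (a + b + c) (a + b + c) = 0} =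
        {a \<in> F1 P. (\<Sum>i\<in>I1. (2 * b (\<nu> + i)) * a i) + Q3 c \<in> {0}}"
      using form_sum1[OF F_UNIV bc(1) F_UNIV[OF bc(3)]] by auto
    also have "card \<dots> = card P ^ (card I1 - 1) * card {0 :: 'a}"
      by (rule card_affine_form[where k = "i - \<nu>"])
        (use i bc in \<open>auto simp: I1_def I2_def mult_in_P_iff P_diff Q3_in_P_iff F_UNIV\<close>)
    finally show "card {a \<in> F1 P. form (a + b + c) (a + b + c) = 0} = card P ^ (\<nu> - 1)" by simp
  qed
  also have "\<dots> = card ?A * card P ^ (\<nu> - 1)" by (simp add: case_prod_unfold)
  also have "card ?A = (CARD('a) ^ \<nu> - card P ^ \<nu>) * card P ^ \<delta>"
    by (simp add: card_cartesian_product card_F_diff card_supported_funs)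
  finally have Y: "card ?Y = (CARD('a) ^ \<nu> - card P ^ \<nu>) * card P ^ \<delta> * card P ^ (\<nu> - 1)" .
  have "isotropic = ?X \<union> ?Y"
  proof (intro equalityI subsetI)
    fix x assume "x \<in> isotropic"
    then have x: "x \<in> space" "form x x = 0" "\<exists>i<2 * \<nu> + \<delta>. x i \<notin> P"
      by (auto simp: isotropic_def primitive_iff)
    have "\<exists>i\<in>I2. x i \<notin> P" if "\<forall>i\<in>I1. x i \<in> P"
    proof -
      have "cut I3 x \<in> F3 P"
        by (rule Q3_P[of "cut I1 x" "cut I2 x"]) (use x that in \<open>auto simp: cut_in sum_cut\<close>)
      then have "\<forall>i\<in>I3. x i \<in> P" by (simp add: cut_in)
      moreover from x(3) obtain i where "i \<in> I1 \<union> I2 \<union> I3" "x i \<notin> P"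
        by (force simp: I1_def I2_def I3_def)
      ultimately show ?thesis using that by blast
    qed
    then show "x \<in> ?X \<union> ?Y" using x by blast
  next
    fix x assume "x \<in> ?X \<union> ?Y"
    then have "x \<in> space" "form x x = 0" "\<exists>i\<in>I1 \<union> I2. x i \<notin> P" by auto
    moreover from this(3) have "\<exists>i<2 * \<nu> + \<delta>. x i \<notin> P"
      unfolding I1_def I2_def by (metis UnE atLeastLessThan_iff lessThan_iff mult_2 trans_less_add1)
    ultimately show "x \<in> isotropic" by (simp add: isotropic_def primitive_iff)
  qed
  then have "card isotropic = card ?X + card ?Y"
    by (simp only:) (rule card_Un_disjoint, auto simp: finite_supported_funs)
  moreover have "\<delta> + (\<nu> - 1) = \<delta> + \<nu> - 1" using \<nu> by simp
  ultimately show ?thesis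
    using Y card_form_values_unit_I1[of "{0}"] by (simp add: mult.assoc flip: power_add)
qed

lemma card_space: "card space = CARD('a) ^ (2 * \<nu> + \<delta>)"
  by (simp add: card_supported_funs)

end

section \<open>The orthogonal graph\<close>

definition diag_entry :: "nat \<Rightarrow> 'a::comm_ring_1 \<Rightarrow> 'a \<Rightarrow> nat \<Rightarrow> 'a" where
  "diag_entry \<delta> z e j = (if \<delta> = 1 then e else if j = 0 then 1 else - z)"

lemma orth_matrix_dim:
  assumes "\<delta> \<in> {0, 1, 2}"
  shows "dim_row (orth_matrix \<nu> \<delta> z e) = 2 * \<nu> + \<delta>" "dim_col (orth_matrix \<nu> \<delta> z e) = 2 * \<nu> + \<delta>"
  using assms by (auto simp: orth_matrix_def orth_Delta_def mat_of_rows_list_def Let_def)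

lemma orth_matrix_entry:
  fixes z e :: "'a::comm_ring_1"
  assumes \<delta>: "\<delta> \<in> {0, 1, 2}" and ij: "i < 2 * \<nu> + \<delta>" "j < 2 * \<nu> + \<delta>"
  shows "orth_matrix \<nu> \<delta> z e $$ (i, j) =
    (if i < \<nu> then if j = \<nu> + i then 1 else 0
     else if i < 2 * \<nu> then if j = i - \<nu> then 1 else 0
     else if j = i then diag_entry \<delta> z e (i - 2 * \<nu>) else 0)"
proof -
  have dim: "dim_row (orth_Delta \<delta> z e) = \<delta>" "dim_col (orth_Delta \<delta> z e) = \<delta>"
    using \<delta> by (auto simp: orth_Delta_def mat_of_rows_list_def)
  have Delta: "orth_Delta \<delta> z e $$ (k, l) = (if k = l then diag_entry \<delta> z e k else 0)"
    if "k < \<delta>" "l < \<delta>" for k l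
    using that \<delta> by (auto simp: orth_Delta_def diag_entry_def mat_of_rows_list_def less_2_cases_iff)
  define H :: "'a mat" where "H = four_block_mat (0\<^sub>m \<nu> \<nu>) (1\<^sub>m \<nu>) (1\<^sub>m \<nu>) (0\<^sub>m \<nu> \<nu>)"
  have dim_H: "dim_row H = 2 * \<nu>" "dim_col H = 2 * \<nu>" by (simp_all add: H_def)
  have H: "H $$ (k, l) = (if k < \<nu> then if l = \<nu> + k then 1 else 0 else if l = k - \<nu> then 1 else 0)"
    if "k < 2 * \<nu>" "l < 2 * \<nu>" for k l
    using that by (auto simp: H_def)
  have "orth_matrix \<nu> \<delta> z e $$ (i, j) =
      (if i < 2 * \<nu> then if j < 2 * \<nu> then H $$ (i, j) else 0
       else if j < 2 * \<nu> then 0 else orth_Delta \<delta> z e $$ (i - 2 * \<nu>, j - 2 * \<nu>))"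
    unfolding orth_matrix_def H_def[symmetric] using ij by (simp add: dim dim_H)
  moreover have "i - 2 * \<nu> < \<delta>" "j - 2 * \<nu> < \<delta>" if "\<not> i < 2 * \<nu>" "\<not> j < 2 * \<nu>"
    using that ij by linarith+
  moreover have "i - 2 * \<nu> = j - 2 * \<nu> \<longleftrightarrow> j = i" if "\<not> i < 2 * \<nu>" "\<not> j < 2 * \<nu>"
    using that by linarith
  ultimately show ?thesis by (simp add: H Delta) linarith
qed

text \<open>Each row of \<open>S\<close> vanishes outside one column: the hyperbolic partner index,
  or the diagonal on the last block. So the product with \<open>y\<close> has the entries
  \<open>g i\<close>.\<close>

lemma orth_form_vec:
  fixes z e :: "'a::comm_ring_1"
  assumes \<delta>: "\<delta> \<in> {0, 1, 2}"
  shows "orth_form \<nu> \<delta> z e (vec (2 * \<nu> + \<delta>) x) (vec (2 * \<nu> + \<delta>) y) =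
    (\<Sum>i<\<nu>. x i * y (\<nu> + i) + x (\<nu> + i) * y i) +
    (\<Sum>j<\<delta>. diag_entry \<delta> z e j * x (2 * \<nu> + j) * y (2 * \<nu> + j))"
proof -
  let ?D = "2 * \<nu> + \<delta>"
  define g where "g i = (if i < \<nu> then y (\<nu> + i) else if i < 2 * \<nu> then y (i - \<nu>)
    else diag_entry \<delta> z e (i - 2 * \<nu>) * y i)" for i
  have row: "(orth_matrix \<nu> \<delta> z e *\<^sub>v vec ?D y) $ i = g i" if i: "i < ?D" for i
  proof -
    have "(orth_matrix \<nu> \<delta> z e *\<^sub>v vec ?D y) $ i = (\<Sum>j\<in>{0..<?D}. orth_matrix \<nu> \<delta> z e $$ (i, j) * y j)"
      using i by (simp add: orth_matrix_dim[OF \<delta>] scalar_prod_def)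
    also have "\<dots> = (\<Sum>j\<in>{0..<?D}. if j = (if i < \<nu> then \<nu> + i else if i < 2 * \<nu> then i - \<nu> else i)
        then g i else 0)"
      by (rule sum.cong) (use i in \<open>auto simp: orth_matrix_entry[OF \<delta>] g_def\<close>)
    also have "\<dots> = g i" using i by (subst sum.delta) auto
    finally show ?thesis .
  qed
  have "orth_form \<nu> \<delta> z e (vec ?D x) (vec ?D y) = (\<Sum>i\<in>{0..<?D}. x i * g i)"
    unfolding orth_form_def scalar_prod_def
    by (rule sum.cong) (auto simp: orth_matrix_dim[OF \<delta>] row simp del: index_mult_mat_vec)
  \<comment> \<open>The blocks are written as shifted intervals so that each sum can be reindexed
    from 0.\<close>
  also have "\<dots> = (\<Sum>i\<in>{0..<\<nu>}. x i * g i) + (\<Sum>i\<in>{0 + \<nu>..<\<nu> + \<nu>}. x i * g i) +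
      (\<Sum>i\<in>{0 + 2 * \<nu>..<\<delta> + 2 * \<nu>}. x i * g i)"
    by (simp add: sum.atLeastLessThan_concat add.commute mult_2)
  also have "\<dots> = (\<Sum>i<\<nu>. x i * y (\<nu> + i)) + (\<Sum>i<\<nu>. x (\<nu> + i) * y i) +
      (\<Sum>j<\<delta>. diag_entry \<delta> z e j * x (2 * \<nu> + j) * y (2 * \<nu> + j))"
    unfolding sum.shift_bounds_nat_ivl atLeast0LessThan
    by (intro arg_cong2[of _ _ _ _ "(+)"] sum.cong) (auto simp: g_def mult_ac add.commute)
  finally show ?thesis by (simp add: sum.distrib)
qed

section \<open>Vertices of the graph as isotropic lines\<close>

context orthogonal_space
begin

context
  fixes z e :: 'a
  assumes orth_form_eq: "\<And>x y. orth_form \<nu> \<delta> z e (vec (2 * \<nu> + \<delta>) x) (vec (2 * \<nu> + \<delta>) y) = form x y"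
begin

abbreviation to_vec :: "(nat \<Rightarrow> 'a) \<Rightarrow> 'a vec" where "to_vec \<equiv> vec (2 * \<nu> + \<delta>)"
abbreviation "\<Gamma> \<equiv> orthogonal_graph \<nu> \<delta> z e"
abbreviation "vertex x \<equiv> to_vec ` line x"

lemma inj_on_to_vec: "inj_on to_vec space"
proof (rule inj_onI)
  fix x y assume xy: "x \<in> space" "y \<in> space" "to_vec x = to_vec y"
  show "x = y"
  proof
    fix i show "x i = y i"
    proof (cases "i < 2 * \<nu> + \<delta>")
      case True
      then show ?thesis using arg_cong[OF xy(3), of "\<lambda>v. v $ i"] by simp
    qed (use xy in \<open>simp add: supported_funs_def\<close>)
  qed
qed

lemma isotropic_vecs_eq: "isotropic_vecs \<nu> \<delta> z e = to_vec ` isotropic"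
proof (intro equalityI subsetI)
  fix \<alpha> assume \<alpha>: "\<alpha> \<in> isotropic_vecs \<nu> \<delta> z e"
  define x where "x = cut {..<2 * \<nu> + \<delta>} (\<lambda>i. \<alpha> $ i)"
  have \<alpha>_eq: "\<alpha> = to_vec x" using \<alpha> by (auto simp: isotropic_vecs_def x_def cut_def)
  have "x \<in> space" by (simp add: x_def cut_in_UNIV)
  moreover have "form x x = 0" using \<alpha> by (simp add: isotropic_vecs_def \<alpha>_eq orth_form_eq)
  moreover have "\<exists>i<2 * \<nu> + \<delta>. x i \<notin> P"
    using \<alpha> by (auto simp: isotropic_vecs_def \<alpha>_eq not_in_P_iff)
  ultimately show "\<alpha> \<in> to_vec ` isotropic" by (simp add: \<alpha>_eq isotropic_def primitive_iff)
next
  fix \<alpha> assume "\<alpha> \<in> to_vec ` isotropic"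
  then show "\<alpha> \<in> isotropic_vecs \<nu> \<delta> z e"
    by (auto simp: isotropic_vecs_def isotropic_def primitive_iff orth_form_eq not_in_P_iff)
qed

lemma unit_class_to_vec: "unit_class (to_vec x) = vertex x"
proof -
  have "u \<cdot>\<^sub>v to_vec x = to_vec (scal u x)" for u by (auto simp: scal_def)
  then show ?thesis by (auto simp: unit_class_def line_def P_iff image_image)
qed

lemma pverts_graph: "pverts \<Gamma> = vertex ` isotropic"
  by (simp add: orthogonal_graph_def isotropic_vecs_eq image_image unit_class_to_vec)

lemma inj_on_image_to_vec: "inj_on ((`) to_vec) (line ` isotropic)"
  by (rule inj_on_image, rule inj_on_subset[OF inj_on_to_vec])
    (use line_subset_V in \<open>auto simp: isotropic_def\<close>)

lemma vertex_eqD: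
  assumes "vertex x = vertex y" "x \<in> isotropic" "y \<in> isotropic"
  obtains u where "u \<notin> P" "x = scal u y"
proof -
  have "line x = line y" using inj_onD[OF inj_on_image_to_vec assms(1)] assms by blast
  then show thesis using that by (rule line_eqD)
qed

lemma card_vertex_image: "A \<subseteq> isotropic \<Longrightarrow> card (vertex ` A) = card (line ` A)"
  using card_image[OF inj_on_subset[OF inj_on_image_to_vec], of "line ` A"]
  by (auto simp: image_image)

text \<open>An arc only asserts that some representatives pair to a unit; any others differ from
  them by unit factors, by bilinearity without effect on that.\<close>

lemma parcs_graph_iff:
  assumes "x \<in> isotropic" "y \<in> isotropic"
  shows "(vertex x, vertex y) \<in> parcs \<Gamma> \<longleftrightarrow> form x y \<notin> P"
proof
  assume "(vertex x, vertex y) \<in> parcs \<Gamma>"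
  then obtain x' y' where *: "x' \<in> isotropic" "y' \<in> isotropic" "form x' y' \<notin> P"
    "vertex x = vertex x'" "vertex y = vertex y'"
    by (auto simp: orthogonal_graph_def isotropic_vecs_eq unit_class_to_vec orth_form_eq P_iff)
  from assms * obtain u v where "u \<notin> P" "x = scal u x'" "v \<notin> P" "y = scal v y'"
    by (metis vertex_eqD)
  then show "form x y \<notin> P" using * by (simp add: bilinear mult_in_P_iff)
next
  assume "form x y \<notin> P"
  then have "orth_form \<nu> \<delta> z e (to_vec x) (to_vec y) dvd 1" by (simp add: P_iff orth_form_eq)
  then show "(vertex x, vertex y) \<in> parcs \<Gamma>" using assms
    unfolding orthogonal_graph_def isotropic_vecs_eq unit_class_to_vec[symmetric] pair_pre_digraph.simps
    by blast
qed

lemma parcs_graph_subset: "parcs \<Gamma> \<subseteq> pverts \<Gamma> \<times> pverts \<Gamma>"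
  by (auto simp: orthogonal_graph_def)

lemma pair_graph_graph: "pair_graph \<Gamma>"
proof -
  have fin: "finite (pverts \<Gamma>)"
    unfolding pverts_graph using fin_V by (simp add: isotropic_def)
  show ?thesis
  proof (unfold_locales)
    show "finite (parcs \<Gamma>)" using parcs_graph_subset fin by (meson finite_SigmaI finite_subset)
    show "fst a \<in> pverts \<Gamma>" "snd a \<in> pverts \<Gamma>" if "a \<in> parcs \<Gamma>" for a
      using that parcs_graph_subset by auto
    show "fst a \<noteq> snd a" if "a \<in> parcs \<Gamma>" for a
    proof
      assume eq: "fst a = snd a"
      have "fst a \<in> vertex ` isotropic"
        using subsetD[OF parcs_graph_subset that] by (simp add: mem_Times_iff pverts_graph)
      then obtain x where x: "x \<in> isotropic" "fst a = vertex x" by blast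
      then have "(vertex x, vertex x) \<in> parcs \<Gamma>" using that eq by (metis prod.collapse)
      then show False using x by (simp add: parcs_graph_iff) (simp add: isotropic_def)
    qed
    have "(v, u) \<in> parcs \<Gamma>" if "(u, v) \<in> parcs \<Gamma>" for u v
    proof -
      from subsetD[OF parcs_graph_subset that]
      obtain x y where xy: "x \<in> isotropic" "y \<in> isotropic" "u = vertex x" "v = vertex y"
        unfolding pverts_graph by blast
      then show ?thesis using that by (simp add: parcs_graph_iff B_sym[of x y])
    qed
    then show "symmetric (with_proj \<Gamma>)" by (auto simp: symmetric_def sym_def)
  qed (rule fin)
qed

lemma neighbours_inter:
  assumes "x \<in> isotropic" "y \<in> isotropic"
  shows "neighbours \<Gamma> (vertex x) \<inter> neighbours \<Gamma> (vertex y) =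
    vertex ` {t \<in> isotropic. form x t \<notin> P \<and> form y t \<notin> P}"
  using assms by (auto simp: neighbours_def pverts_graph parcs_graph_iff)

lemma card_perp:
  assumes "hyperbolic x y"
  shows "card (perp x y) = CARD('a) ^ (2 * \<nu> - 2 + \<delta>)"
proof -
  have "2 * \<nu> + \<delta> = 2 + (2 * \<nu> - 2 + \<delta>)" using \<nu> by simp
  then have "CARD('a) ^ 2 * card (perp x y) = CARD('a) ^ 2 * CARD('a) ^ (2 * \<nu> - 2 + \<delta>)"
    using card_V_hyperbolic[OF assms] card_space by (metis power_add)
  then show ?thesis by simp
qed

text \<open>The equation relates \<open>l\<close> to quantities independent of \<open>x\<close> and
  \<open>y\<close>, so it serves both to show that \<open>l\<close> is constant and to compute it.
  The bound \<open>l \<le> k\<close> makes the truncated difference \<open>k - l\<close> a true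
  one.\<close>

lemma card_common_adjacent:
  assumes xy: "x \<in> isotropic" "y \<in> isotropic" "form x y \<notin> P"
  defines "l \<equiv> card (neighbours \<Gamma> (vertex x) \<inter> neighbours \<Gamma> (vertex y))"
    and "k \<equiv> CARD('a) ^ (2 * \<nu> - 2 + \<delta>)"
  shows "l \<le> k" "card {x \<in> space. form x x \<in> P} =
    k * card (- P) * card P + (k - l) * card P * CARD('a)"
proof -
  obtain v where v: "v \<notin> P" "hyperbolic x (scal v y)" using hyperbolic_rescale[OF xy] .
  let ?W = "perp x (scal v y)"
  have l: "l = card {w \<in> ?W. form w w \<notin> P}"
    unfolding l_def neighbours_inter[OF xy(1,2)]
    using card_vertex_image card_common_neighbour_lines_adjacent[OF v(2,1)] by simp
  have "card ({w \<in> ?W. form w w \<notin> P} \<union> {w \<in> ?W. form w w \<in> P}) = l + card {w \<in> ?W. form w w \<in> P}"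
    unfolding l by (rule card_Un_disjoint) auto
  moreover have "{w \<in> ?W. form w w \<notin> P} \<union> {w \<in> ?W. form w w \<in> P} = ?W" by auto
  ultimately have "card ?W = l + card {w \<in> ?W. form w w \<in> P}" by simp
  then have kl: "k = l + card {w \<in> ?W. form w w \<in> P}" by (simp add: card_perp[OF v(2)] k_def)
  then show "l \<le> k" by simp
  show "card {x \<in> space. form x x \<in> P} = k * card (- P) * card P + (k - l) * card P * CARD('a)"
    using card_singular_hyperbolic[OF v(2)] kl by (simp add: card_perp[OF v(2)] k_def)
qed

lemma card_common_nonadjacent:
  assumes xy: "x \<in> isotropic" "y \<in> isotropic" "form x y \<in> P"
  defines "c \<equiv> card (neighbours \<Gamma> (vertex x) \<inter> neighbours \<Gamma> (vertex y))"
    and "k \<equiv> CARD('a) ^ (2 * \<nu> - 2 + \<delta>)"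
  shows "c = k \<or> c * CARD('a) = k * card (- P)"
proof -
  obtain f where f: "hyperbolic x f" using hyperbolic_exists[OF xy(1)] .
  have "c = card (line ` {t \<in> isotropic. form x t \<notin> P \<and> form y t \<notin> P})"
    unfolding c_def neighbours_inter[OF xy(1,2)] by (rule card_vertex_image) auto
  then show ?thesis
    using card_common_neighbour_lines_nonadjacent[OF f xy(2,3)] by (simp add: card_perp[OF f] k_def)
qed

lemma card_neighbours:
  assumes "x \<in> isotropic"
  shows "card (neighbours \<Gamma> (vertex x)) = CARD('a) ^ (2 * \<nu> - 2 + \<delta>)"
proof -
  obtain f where f: "hyperbolic x f" using hyperbolic_exists[OF assms] .
  show ?thesis
    using neighbours_inter[OF assms assms] card_neighbour_lines[OF f]
    by (simp add: card_vertex_image card_perp[OF f])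
qed

lemma isotropic_nonempty: "isotropic \<noteq> {}"
proof -
  have "CARD('a) ^ \<nu> > card P ^ \<nu>" using card_P_less \<nu> by (simp add: power_strict_mono)
  then have "card isotropic > 0" unfolding card_isotropic by simp
  then show ?thesis by auto
qed

text \<open>The parameters are pinned down by equations between natural numbers, to be solved once
  the cardinalities of the ring and of \<open>P\<close> are known.\<close>

theorem quasi_strongly_regular_graph:
  assumes c: "c * CARD('a) = CARD('a) ^ (2 * \<nu> - 2 + \<delta>) * card (- P)"
  defines "k \<equiv> CARD('a) ^ (2 * \<nu> - 2 + \<delta>)"
  obtains n l where "card (- P) * n = card isotropic" "l \<le> k"
    "card {x \<in> space. form x x \<in> P} = k * card (- P) * card P + (k - l) * card P * CARD('a)"
    "quasi_strongly_regular \<Gamma> n k l [c, k]"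
proof -
  obtain x0 where x0: "x0 \<in> isotropic" using isotropic_nonempty by blast
  obtain f0 where f0: "hyperbolic x0 f0" using hyperbolic_exists[OF x0] .
  have f0': "f0 \<in> isotropic" "form x0 f0 \<notin> P"
    using hyperbolicD[OF f0] by (auto simp: isotropic_def primitive_def intro!: bexI[of _ x0])
  define l where "l = card (neighbours \<Gamma> (vertex x0) \<inter> neighbours \<Gamma> (vertex f0))"
  define n where "n = card (pverts \<Gamma>)"
  note l0 = card_common_adjacent[OF x0 f0', folded l_def k_def]
  have R: "CARD('a) > 0" and U: "card (- P) > 0" and P0: "card P > 0"
    using card_P_less card_units by (simp_all) (metis card_gt_0_iff empty_iff finite_P zero_in_P)
  have k0: "k > 0" by (simp add: k_def)
  have c0: "c > 0" using c U k0 by (metis k_def gr0I mult_eq_0_iff not_gr0)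
  \<comment> \<open>\<open>P\<close> contains 0, so the units are not the whole ring; this separates
    \<open>c\<close> from \<open>k\<close>, as distinctness of the parameters demands.\<close>
  have "card (- P) < CARD('a)" using P0 card_P_less card_units by simp
  then have "c \<noteq> k" using c k0 unfolding k_def[symmetric] by auto
  have n: "card (- P) * n = card isotropic"
    unfolding n_def pverts_graph using card_lines by (simp add: card_vertex_image)
  have l: "card (neighbours \<Gamma> (vertex x) \<inter> neighbours \<Gamma> (vertex y)) = l"
    if xy: "x \<in> isotropic" "y \<in> isotropic" "form x y \<notin> P" for x y
  proof -
    define l' where "l' = card (neighbours \<Gamma> (vertex x) \<inter> neighbours \<Gamma> (vertex y))"
    note l' = card_common_adjacent[OF xy, folded l'_def k_def]
    have "(k - l') * (card P * CARD('a)) = (k - l) * (card P * CARD('a))"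
      using trans[OF l'(2)[symmetric] l0(2)] by (simp only: add_left_cancel mult.assoc)
    moreover have "0 < card P * CARD('a)" using R P0 by simp
    ultimately have "k - l' = k - l" unfolding mult_cancel2 by linarith
    then show ?thesis using l'(1) l0(1) unfolding l'_def by linarith
  qed
  have nonadj: "card (neighbours \<Gamma> (vertex x) \<inter> neighbours \<Gamma> (vertex y)) \<in> {c, k}"
    if "x \<in> isotropic" "y \<in> isotropic" "form x y \<in> P" for x y
    using card_common_nonadjacent[OF that, folded k_def]
  proof
    assume "card (neighbours \<Gamma> (vertex x) \<inter> neighbours \<Gamma> (vertex y)) * CARD('a) = k * card (- P)"
    also have "\<dots> = c * CARD('a)" using c by (simp add: k_def)
    finally show ?thesis by simp
  qed simp
  \<comment> \<open>Both \<open>c\<close> and \<open>k\<close> are positive, so non-adjacent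
    vertices are joined by a path of length two.\<close>
  have "(u, v) \<in> rtrancl_on (pverts \<Gamma>) (symcl (parcs \<Gamma>))"
    if uv: "u \<in> pverts \<Gamma>" "v \<in> pverts \<Gamma>" for u v
  proof -
    from uv obtain x y where xy: "x \<in> isotropic" "y \<in> isotropic" "u = vertex x" "v = vertex y"
      by (auto simp: pverts_graph)
    show ?thesis
    proof (cases "form x y \<in> P")
      case False
      then have "(u, v) \<in> symcl (parcs \<Gamma>)" using xy by (simp add: parcs_graph_iff symcl_def)
      then show ?thesis using uv by (blast intro: rtrancl_on_into_rtrancl_on)
    next
      case True
      then have "card (neighbours \<Gamma> u \<inter> neighbours \<Gamma> v) \<noteq> 0"
        using nonadj[OF xy(1,2)] c0 k0 xy by auto
      then have "neighbours \<Gamma> u \<inter> neighbours \<Gamma> v \<noteq> {}" by (metis card.empty)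
      then obtain w where w: "w \<in> pverts \<Gamma>" "(u, w) \<in> parcs \<Gamma>" "(v, w) \<in> parcs \<Gamma>"
        unfolding neighbours_def by blast
      then have "(u, w) \<in> symcl (parcs \<Gamma>)" "(w, v) \<in> symcl (parcs \<Gamma>)"
        by (force simp: symcl_def)+
      then show ?thesis using uv w(1) by (blast intro: rtrancl_on_into_rtrancl_on)
    qed
  qed
  then have "Digraph_Component.connected (with_proj \<Gamma>)"
    using isotropic_nonempty by (simp add: connected_conv) (simp add: pverts_graph)
  then have "quasi_strongly_regular \<Gamma> n k l [c, k]"
    unfolding quasi_strongly_regular_def
    using \<open>c \<noteq> k\<close> pair_graph_graph n_def card_neighbours l nonadj
    by (simp add: k_def pverts_graph parcs_graph_iff)
  with n l0 show thesis by (rule that)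
qed

end

end

section \<open>Closed forms of the parameters\<close>

text \<open>Here \<open>q\<close> stands for the order of the residue field, \<open>r\<close> for
  \<open>card P\<close> and \<open>N\<close> for the number given by \<open>card_singular\<close>.
  The equation is linear in \<open>l\<close> with coefficient \<open>q * r * r\<close>, and its
  solution has one shape for all \<open>\<delta>\<close>.\<close>

lemma solve_lambda:
  fixes q r l k N :: real
  assumes "q > 1" "r > 0" "\<nu> \<ge> 1" and k: "k = (q * r) ^ (2 * \<nu> - 2 + \<delta>)"
    and N: "N = ((q * r) ^ \<nu> - r ^ \<nu>) * (q * r) ^ \<delta> * ((q * r) ^ (\<nu> - 1) * r) +
      r ^ \<nu> * (q * r) ^ \<nu> * r ^ \<delta>"
    and eq: "N = k * (q * r - r) * r + (k - l) * r * (q * r)"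
  shows "l = k * ((q - 1) / q + 1 / q ^ \<nu> - q / q ^ (\<nu> + \<delta>))"
proof -
  \<comment> \<open>This turns the truncated exponents \<open>2 * \<nu> - 2\<close> and
    \<open>\<nu> - 1\<close> into sums.\<close>
  obtain a where a: "\<nu> = Suc a" using \<open>\<nu> \<ge> 1\<close> by (cases \<nu>) auto
  have "k = (q * r) ^ (a + a + \<delta>)" unfolding k a by (simp add: mult_2)
  then have k': "k = q ^ a * q ^ a * q ^ \<delta> * (r ^ a * r ^ a * r ^ \<delta>)"
    by (simp only: power_add power_mult_distrib mult_ac)
  have nz: "q \<noteq> 0" "r \<noteq> 0" using assms by auto
  have "l * (q * r * r) = k * (2 * q - 1) * (r * r) - N"
    unfolding eq by (simp add: algebra_simps)
  also have "\<dots> = k * ((q - 1) / q + 1 / q ^ \<nu> - q / q ^ (\<nu> + \<delta>)) * (q * r * r)"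
    unfolding N k' a using nz by (simp add: power_mult_distrib power_add field_simps)
  finally show ?thesis using nz by simp
qed

theorem theorem3p4:
  fixes p s m \<nu> \<delta> :: nat
    and z e :: "'a::{finite, comm_ring_1}"
  assumes "prime p" and "odd p"
    and "s \<ge> 2" and "m \<ge> 1"
    and "galois_ring TYPE('a) p s m"
    and "\<nu> \<ge> 2" and "\<delta> \<in> {0, 1, 2}"
    and "z dvd 1" and "\<nexists>y. z = y ^ 2"
    and "e \<in> {1, z}"
  shows "\<exists>n k l c1 c2 :: nat.
     real n = (real p ^ (m * \<nu>) - 1) * (real p ^ (m * (\<nu> + \<delta> - 1)) + 1)
                * real p ^ (m * (s - 1) * (2 * \<nu> - 2 + \<delta>)) / (real p ^ m - 1) \<and>
     real k = real p ^ (m * s * (2 * \<nu> - 2 + \<delta>)) \<and>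
     real l = (real p ^ m - 1)
                * (1 + (real \<delta> - 1) * real p powr (real m * (1 - real \<nu> - real \<delta> / 2)))
                * real p ^ (m * (2 * s * \<nu> - 2 * s - 1 + s * \<delta>)) \<and>
     real c1 = (real p ^ m - 1) * real p ^ (m * (s * (2 * \<nu> - 2 + \<delta>) - 1)) \<and>
     real c2 = real p ^ (m * s * (2 * \<nu> - 2 + \<delta>)) \<and>
     quasi_strongly_regular (orthogonal_graph \<nu> \<delta> z e) n k l [c1, c2]"
proof -
  define P where "P = {x::'a. \<not> x dvd 1}"
  obtain h :: 'a where "odd_local_ring P h"
    unfolding P_def using galois_ring_odd_local_ring[OF assms(5,2)] .
  then interpret odd_local_ring P h .
  define d where "d = diag_entry \<delta> z e"
  have zP: "z \<notin> P" using assms(8) by (simp add: P_def)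
  have d_unit: "d j \<notin> P" for j
    using assms(10) zP by (auto simp: d_def diag_entry_def)
  \<comment> \<open>For \<open>\<delta> = 1\<close> the single coefficient is a unit; for
    \<open>\<delta> = 2\<close> the form is the norm form of the non-square
    \<open>z\<close>.\<close>
  have aniso: "x j \<in> P" if sum: "(\<Sum>j<\<delta>. d j * x j * x j) \<in> P" and j: "j < \<delta>" for x j
  proof -
    consider "\<delta> = 1" | "\<delta> = 2" using assms(7) j by auto
    then show ?thesis
    proof cases
      case 1
      then show ?thesis using sum j d_unit by (simp add: mult_in_P_iff)
    next
      case 2
      then have "x 0 * x 0 - z * (x 1 * x 1) \<in> P"
        using sum by (simp add: numeral_2_eq_2 d_def diag_entry_def mult.assoc)
      then have "x 0 \<in> P \<and> x 1 \<in> P" using norm_form_in_P[OF zP assms(9)] by blast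
      then show ?thesis using j 2 by (auto simp: less_2_cases_iff)
    qed
  qed
  interpret orthogonal_space P h \<nu> \<delta> d
    using assms(6) d_unit aniso by unfold_locales auto
  have form_eq: "orth_form \<nu> \<delta> z e (vec (2 * \<nu> + \<delta>) x) (vec (2 * \<nu> + \<delta>) y) = form x y" for x y
    unfolding form_def unfolding d_def by (rule orth_form_vec[OF assms(7)])

  \<comment> \<open>\<open>q\<close> is the order of the residue field and \<open>r\<close> that of
    \<open>P\<close>; \<open>E\<close> is the exponent with \<open>k = CARD('a) ^ E\<close>.\<close>
  define q where "q = p ^ m"
  define r where "r = q ^ (s - 1)"
  define E where "E = 2 * \<nu> - 2 + \<delta>"
  have q1: "q > 1" unfolding q_def
    by (rule one_less_power) (use prime_gt_1_nat[OF assms(1)] assms(4) in auto)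
  have r0: "r > 0" using q1 by (simp add: r_def)
  have s1: "s = Suc (s - 1)" using assms(3) by simp
  have "q * r = q ^ s" unfolding r_def by (subst (2) s1) simp
  then have cardR: "CARD('a) = q * r"
    using assms(5) by (simp add: galois_ring_def q_def mult.commute flip: power_mult)
  have cardP: "card P = r"
    using galois_ring_card_nonunits[OF assms(5)] assms(3) by (simp add: P_def q_def r_def flip: power_mult)
  have cardU: "card (- P) = q * r - r" by (simp add: card_units cardR cardP)
  define k where "k = CARD('a) ^ E"
  \<comment> \<open>This is \<open>k * (q - 1) / q\<close>, the proportion of units in the ring
    being \<open>(q - 1) / q\<close>; the exponent is not truncated because \<open>s * E\<close> is
    positive.\<close>
  define c where "c = (q - 1) * q ^ (s * E - 1)"
  have E0: "E > 0" using assms(6) by (simp add: E_def)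
  have sE: "s * E = Suc (s * E - 1)" using E0 assms(3) by simp
  have k_eq: "k = q ^ (s * E)"
    unfolding k_def cardR \<open>q * r = q ^ s\<close> by (simp add: power_mult)
  then have k_eq': "k = q * q ^ (s * E - 1)" by (subst (asm) sE) simp
  have "card (- P) = (q - 1) * r" by (simp add: cardU diff_mult_distrib)
  then have "c * (q * r) = k * card (- P)" unfolding k_eq' c_def by (simp add: mult_ac)
  then have c_eq: "c * CARD('a) = CARD('a) ^ E * card (- P)" by (simp add: k_def cardR)
  obtain n l where n: "card (- P) * n = card isotropic" and lk: "l \<le> k"
    and l: "card {x \<in> space. form x x \<in> P} = k * card (- P) * card P + (k - l) * card P * CARD('a)"
    and qsr: "quasi_strongly_regular (orthogonal_graph \<nu> \<delta> z e) n k l [c, k]"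
    using quasi_strongly_regular_graph[OF form_eq c_eq[unfolded E_def]]
    unfolding k_def E_def by blast
  have q': "real q = real p ^ m" and r': "real r = real q ^ (s - 1)" by (simp_all add: q_def r_def)
  have qr: "real q > 1" "real r > 0" "real q \<noteq> 0" "real r \<noteq> 0" "real q - 1 \<noteq> 0" using q1 r0 by auto
  have le: "r \<le> q * r" "r ^ \<nu> \<le> (q * r) ^ \<nu>" using q1 by (auto intro: power_mono)
  have "real n = (real p ^ (m * \<nu>) - 1) * (real p ^ (m * (\<nu> + \<delta> - 1)) + 1)
                * real p ^ (m * (s - 1) * (2 * \<nu> - 2 + \<delta>)) / (real p ^ m - 1)"
  proof -
    obtain a where a: "\<nu> = Suc a" using assms(6) by (cases \<nu>) auto
    have E_eq: "2 * \<nu> - 2 + \<delta> = a + a + \<delta>" using a by simp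
    have "real (card (- P) * n) = real (card isotropic)" using n by simp
    then have "(q * r - r) * real n = ((q * r) ^ \<nu> - real r ^ \<nu>) * (real (q * r) ^ (\<delta> + \<nu> - 1) + real r ^ (\<delta> + \<nu> - 1))"
      unfolding card_isotropic cardU cardR cardP using le by (simp add: of_nat_diff algebra_simps)
    \<comment> \<open>The units contribute \<open>(q - 1) * r\<close> and the isotropic vectors a
      power of \<open>r\<close> with exponent \<open>2 * \<nu> - 1 + \<delta>\<close>, so one factor
      \<open>r\<close> cancels.\<close>
    then have "((real q - 1) * real n) * r = ((real q ^ \<nu> - 1) * (real q ^ (\<nu> + \<delta> - 1) + 1) * real r ^ (2 * \<nu> - 2 + \<delta>)) * r"
      using le unfolding E_eq unfolding a
      by (simp add: of_nat_diff algebra_simps power_mult_distrib power_add)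
    then have "(real q - 1) * real n = (real q ^ \<nu> - 1) * (real q ^ (\<nu> + \<delta> - 1) + 1) * real r ^ (2 * \<nu> - 2 + \<delta>)"
      using mult_right_cancel[OF qr(4)] by blast
    then have "real n = (real q ^ \<nu> - 1) * (real q ^ (\<nu> + \<delta> - 1) + 1) * real r ^ (2 * \<nu> - 2 + \<delta>) / (real q - 1)"
      by (metis qr(5) nonzero_mult_div_cancel_left)
    then show ?thesis by (simp add: q' r' mult.assoc flip: power_mult)
  qed
  moreover have k_real: "real k = real p ^ (m * s * (2 * \<nu> - 2 + \<delta>))"
    by (simp add: k_eq q' E_def mult.assoc flip: power_mult)
  moreover have "real c = (real p ^ m - 1) * real p ^ (m * (s * (2 * \<nu> - 2 + \<delta>) - 1))"
    using q1 by (simp add: c_def of_nat_diff E_def power_mult q')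
  moreover have "real l = (real p ^ m - 1)
                * (1 + (real \<delta> - 1) * real p powr (real m * (1 - real \<nu> - real \<delta> / 2)))
                * real p ^ (m * (2 * s * \<nu> - 2 * s - 1 + s * \<delta>))"
  proof -
    have "real (card {x \<in> space. form x x \<in> P}) =
        real (k * card (- P) * card P + (k - l) * card P * CARD('a))" using l by simp
    then have eq: "((q * r) ^ \<nu> - real r ^ \<nu>) * (q * real r) ^ \<delta> * ((q * r) ^ (\<nu> - 1) * real r) +
        real r ^ \<nu> * (q * real r) ^ \<nu> * real r ^ \<delta> = real k * (q * real r - r) * r + (real k - l) * r * (q * real r)"
      unfolding card_singular cardU cardR cardP using le lk by (simp add: of_nat_diff)
    have l_eq: "real l = real k * ((real q - 1) / q + 1 / real q ^ \<nu> - q / real q ^ (\<nu> + \<delta>))"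
      by (rule solve_lambda[OF qr(1,2) _ _ refl])
        (use assms(6) eq in \<open>simp_all add: k_def cardR E_def\<close>)
    \<comment> \<open>The subtractions on the left are genuine because \<open>\<nu>\<close> and
      \<open>s\<close> are at least 2, so this power of \<open>p ^ m\<close> is
      \<open>k / q\<close>.\<close>
    have "2 * s * \<nu> - 2 * s - 1 + s * \<delta> = s * E - 1"
    proof -
      obtain a where "\<nu> = Suc (Suc a)" using assms(6) by (auto dest!: le_Suc_ex simp: numeral_2_eq_2)
      then show ?thesis using assms(3) by (simp add: E_def algebra_simps)
    qed
    then have pow: "real p ^ (m * (2 * s * \<nu> - 2 * s - 1 + s * \<delta>)) = real k / q"
      using qr by (simp add: k_eq' power_mult q')
    have p0: "real p > 0" using prime_gt_0_nat[OF assms(1)] by simp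
    have powr: "real p powr (- real (m * i)) = 1 / real q ^ i" for i
      unfolding powr_minus powr_realpow[OF p0] by (simp add: q' power_mult divide_inverse)
    \<comment> \<open>For \<open>\<delta> = 1\<close> the correction term vanishes. Otherwise
      \<open>\<delta> / 2\<close> is an integer, so the real power becomes the reciprocal of
      \<open>q ^ (\<nu> - 1)\<close> or \<open>q ^ \<nu>\<close>.\<close>
    consider "\<delta> = 0" | "\<delta> = 1" | "\<delta> = 2" using assms(7) by auto
    then show ?thesis
    proof cases
      case 1
      have "real m * (1 - real \<nu> - real \<delta> / 2) = - real (m * (\<nu> - 1))"
        using 1 assms(6) by (simp add: of_nat_diff algebra_simps)
      moreover obtain a where "\<nu> = Suc a" using assms(6) by (cases \<nu>) auto
      ultimately show ?thesis
        unfolding l_eq pow using powr[of "\<nu> - 1"] 1 qr by (simp add: field_simps flip: q')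
    next
      case 2
      then show ?thesis unfolding l_eq pow using qr by (simp add: field_simps flip: q')
    next
      case 3
      have "real m * (1 - real \<nu> - real \<delta> / 2) = - real (m * \<nu>)"
        using 3 by (simp add: algebra_simps)
      then show ?thesis
        unfolding l_eq pow using powr[of \<nu>] 3 qr by (simp add: field_simps power2_eq_square flip: q')
    qed
  qed
  ultimately show ?thesis using qsr by blast
qed

end
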